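(* Let $2<p<6$ and $\alpha<0$. Then for every $\mu>0$ there exists a unique positive ground state of $F$ at mass $\mu$.
   Context: Let $\mathbb{R}^+=(0,+\infty)$. For $p\in(2,6]$ and $\alpha\in\mathbb{R}$, the energy is $$F(u)=\frac12\int_0^{+\infty}|u'|^2\,dx-\frac1p\int_0^{+\infty}|u|^p\,dx+\frac{\alpha}{2}|u(0)|^2,\qquad u\in H^1(\mathbb{R}^+),$$ where $u(0)$ is the value at $0$ of the continuous representative of $u$. For $\mu>0$, $H^1_\mu(\mathbb{R}^+):=\{u\in H^1(\mathbb{R}^+):\int_0^{+\infty}|u|^2\,dx=\mu\}$ and $\mathcal{F}(\mu):=\inf_{u\in H^1_\mu(\mathbb{R}^+)}F(u)$. A ground state of $F$ at mass $\mu$ is a function $u\in H^1_\mu(\mathbb{R}^+)$ with $F(u)=\mathcal{F}(\mu)$. Functions are real-valued (this is not restrictive). *)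

theory Defs
  imports "HOL-Analysis.Analysis"
begin

text \<open>
  The Sobolev space on the half-line \<open>{0<..}\<close>, defined through weak derivatives. Elements are
  functions \<open>real \<Rightarrow> real\<close>, to be identified when they agree almost everywhere on \<open>{0<..}\<close>; their
  values outside \<open>{0<..}\<close> (in particular the junk value at \<open>0\<close>) play no role.
\<close>

abbreviation half_line :: "real measure" where
  "half_line \<equiv> lebesgue_on {0<..}"

definition test_function :: "(real \<Rightarrow> real) \<Rightarrow> bool" where
  "test_function \<phi> \<longleftrightarrow>
     (\<forall>k x. (deriv ^^ k) \<phi> differentiable (at x)) \<and>
     compact (closure {x. \<phi> x \<noteq> 0}) \<and> closure {x. \<phi> x \<noteq> 0} \<subseteq> {0<..}"

definition locally_integrable :: "(real \<Rightarrow> real) \<Rightarrow> bool" where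
  "locally_integrable u \<longleftrightarrow> (\<forall>K. compact K \<and> K \<subseteq> {0<..} \<longrightarrow> integrable (lebesgue_on K) u)"

definition has_weak_derivative :: "(real \<Rightarrow> real) \<Rightarrow> (real \<Rightarrow> real) \<Rightarrow> bool" where
  "has_weak_derivative u g \<longleftrightarrow> locally_integrable u \<and> locally_integrable g \<and>
     (\<forall>\<phi>. test_function \<phi> \<longrightarrow>
        (LINT x|half_line. u x * deriv \<phi> x) = - (LINT x|half_line. g x * \<phi> x))"

text \<open>The weak derivative is unique up to almost everywhere equality on \<open>{0<..}\<close>.\<close>

definition weak_deriv :: "(real \<Rightarrow> real) \<Rightarrow> (real \<Rightarrow> real)" where
  "weak_deriv u = (SOME g. has_weak_derivative u g)"

definition L2 :: "(real \<Rightarrow> real) set" where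
  "L2 = {u \<in> borel_measurable half_line. integrable half_line (\<lambda>x. \<bar>u x\<bar>\<^sup>2)}"

definition H1 :: "(real \<Rightarrow> real) set" where
  "H1 = {u \<in> L2. \<exists>g \<in> L2. has_weak_derivative u g}"

text \<open>
  For \<open>u \<in> H1\<close> the continuous representative extends continuously up to the boundary point \<open>0\<close> and
  is uniquely determined on \<open>{0..}\<close>.
\<close>

definition cont_rep :: "(real \<Rightarrow> real) \<Rightarrow> (real \<Rightarrow> real)" where
  "cont_rep u = (SOME v. continuous_on {0..} v \<and> (AE x in half_line. v x = u x))"

definition energy :: "real \<Rightarrow> real \<Rightarrow> (real \<Rightarrow> real) \<Rightarrow> real" where
  "energy p \<alpha> u =
     1 / 2 * (LINT x|half_line. \<bar>weak_deriv u x\<bar>\<^sup>2)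
     - 1 / p * (LINT x|half_line. \<bar>u x\<bar> powr p)
     + \<alpha> / 2 * \<bar>cont_rep u 0\<bar>\<^sup>2"

definition H1_mass :: "real \<Rightarrow> (real \<Rightarrow> real) set" where
  "H1_mass \<mu> = {u \<in> H1. (LINT x|half_line. \<bar>u x\<bar>\<^sup>2) = \<mu>}"

text \<open>The infimum is taken in \<open>ereal\<close>, so that it is meaningful without a lower bound on the energy.\<close>

definition energy_level :: "real \<Rightarrow> real \<Rightarrow> real \<Rightarrow> ereal" where
  "energy_level p \<alpha> \<mu> = (INF u \<in> H1_mass \<mu>. ereal (energy p \<alpha> u))"

definition ground_state :: "real \<Rightarrow> real \<Rightarrow> real \<Rightarrow> (real \<Rightarrow> real) \<Rightarrow> bool" where
  "ground_state p \<alpha> \<mu> u \<longleftrightarrow> u \<in> H1_mass \<mu> \<and> ereal (energy p \<alpha> u) = energy_level p \<alpha> \<mu>"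

definition positive_on_half_line :: "(real \<Rightarrow> real) \<Rightarrow> bool" where
  "positive_on_half_line u \<longleftrightarrow> (\<forall>x>0. cont_rep u x > 0)"

end

theory Submission imports Defs begin

text \<open>
  The functional is convex in hidden coordinates. Take as independent variable the mass
  \<open>t = \<integral>\<^sub>x\<^sup>\<infinity> v\<^sup>2\<close> to the right of \<open>x\<close> and as unknown \<open>z = v\<^sup>4\<close>. The mass constraint becomes a fixed
  interval \<open>{0..\<mu>}\<close> and the energy becomes
  \<open>\<integral> z'\<^sup>2 / (32 z) dt - \<integral> z powr ((p - 2) / 4) dt / p + \<alpha> / 2 * sqrt (z \<mu>)\<close>,
  in which every term is convex when \<open>2 < p < 6\<close> and \<open>\<alpha> < 0\<close>, the second one strictly. Hence a
  positive critical point is the unique positive minimizer, and no compactness argument is needed.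
  The critical point is a shifted soliton \<open>u x = A * cosh (k * x + t) powr (- 2 / (p - 2))\<close>, whose
  shift is adjusted to the mass by the intermediate value theorem.

  Convexity is used in the form of a calibration: subtracting the derivative of
  \<open>- \<kappa> (t x) * (v x) ^ 4 / 4 - (6 - p) / (4 * p) * \<tau> (t x)\<close>, where \<open>\<kappa> = - u' / u ^ 3\<close> and
  \<open>\<tau> = \<integral> u powr p\<close> are taken at the point where the soliton has the same tail mass as \<open>v\<close> at \<open>x\<close>,
  turns the energy density into a sum of nonnegative terms. This works for every \<open>v\<close> in the Sobolev
  space and does not involve the change of variables itself.
\<close>

section \<open>Test functions and weak derivatives\<close>

text \<open>Along \<open>v\<close> one has \<open>dt = - v^2 dx\<close>, which produces the
  transformed energy. Its kinetic part is jointly convex in \<open>z\<close> and \<open>z'\<close>,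
  being the perspective of a square, and \<open>p < 6\<close> says that the exponent
  \<open>(p - 2) / 4\<close> is below 1. The form of \<open>\<kappa>\<close> comes from the square
  \<open>(z' - 4 \<kappa> z)^2 / (32 z)\<close>: it vanishes at the soliton exactly if
  \<open>4 \<kappa>\<close> is the logarithmic derivative of the soliton's \<open>z\<close> in
  \<open>t\<close>. Integrating its cross term by parts and matching the factor of \<open>z\<close>
  with the tangent slope of the nonlinear term turns the Euler-Lagrange equation into a Riccati
  equation for \<open>\<kappa>\<close>. The condition on \<open>\<kappa>\<close> at full mass is the
  boundary condition \<open>u' = \<alpha> u\<close> at 0. The obstacle is the end
  \<open>t = 0\<close>. There the soliton's \<open>\<kappa>\<close> blows up, and a competitor may
  run out of mass at a finite point. So the calibration stops at a point \<open>X\<close> with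
  positive tail mass, and the boundary term created there has to be paid for by the kinetic energy
  beyond \<open>X\<close>.\<close>

definition flat_exp :: "nat \<Rightarrow> real \<Rightarrow> real" where
  "flat_exp j t = (if t > 0 then exp (- 1 / t) / t ^ j else 0)"

text \<open>At \<open>s = 1 / t\<close> a single term of the exponential series bounds
  \<open>s ^ (j + 2)\<close> by a multiple of \<open>exp s\<close>. Of the two spare powers of
  \<open>t\<close> one survives division by \<open>t\<close>, so the difference quotient at 0
  vanishes.\<close>

lemma abs_flat_exp_le: "\<bar>flat_exp j t\<bar> \<le> fact (j + 2) * t\<^sup>2"
proof (cases "t > 0")
  case True
  define s where "s = 1 / t"
  have s: "s > 0" using True by (simp add: s_def)
  have "s ^ (j + 2) /\<^sub>R fact (j + 2) \<le> (\<Sum>n. s ^ n /\<^sub>R fact n)"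
    using sum_le_suminf[OF summable_exp_generic[of s], of "{j + 2}"] s by simp
  hence "s ^ (j + 2) / fact (j + 2) \<le> exp s"
    by (simp add: exp_def divide_inverse mult.commute)
  hence "s ^ (j + 2) \<le> fact (j + 2) * exp s"
    by (simp add: pos_divide_le_eq mult.commute del: fact_Suc add_2_eq_Suc' power_Suc)
  hence "exp (- s) * s ^ (j + 2) \<le> fact (j + 2)"
    by (simp add: exp_minus field_simps)
  hence "exp (- s) * s ^ (j + 2) * t\<^sup>2 \<le> fact (j + 2) * t\<^sup>2"
    by (intro mult_right_mono) auto
  moreover have "exp (- s) * s ^ (j + 2) * t\<^sup>2 = flat_exp j t"
    using True by (simp add: flat_exp_def s_def power_divide power_add power2_eq_square)
  ultimately show ?thesis by (simp add: flat_exp_def)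
qed (simp add: flat_exp_def)

lemma has_real_derivative_flat_exp:
  "(flat_exp j has_real_derivative flat_exp (j + 2) t - real j * flat_exp (j + 1) t) (at t)"
proof -
  consider "t > 0" | "t < 0" | "t = 0" by linarith
  then show ?thesis
  proof cases
    case 1
    have "((\<lambda>t. exp (- 1 / t) / t ^ j) has_real_derivative
        flat_exp (j + 2) t - real j * flat_exp (j + 1) t) (at t)"
      using 1
      apply (auto intro!: derivative_eq_intros simp: flat_exp_def)
      apply (cases j)
       apply (auto simp: field_simps power2_eq_square)
      done
    then show ?thesis
      by (rule has_field_derivative_transform_within_open[where S="{0<..}"])
         (use 1 in \<open>auto simp: flat_exp_def\<close>)
  next
    case 2
    have "((\<lambda>t. 0) has_real_derivative 0) (at t)" by simp
    then have "(flat_exp j has_real_derivative 0) (at t)"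
      by (rule has_field_derivative_transform_within_open[where S="{..<0}"])
         (use 2 in \<open>auto simp: flat_exp_def\<close>)
    then show ?thesis using 2 by (simp add: flat_exp_def)
  next
    case 3
    have "((\<lambda>h. fact (j + 2) * \<bar>h\<bar> :: real) \<longlongrightarrow> fact (j + 2) * \<bar>0\<bar>) (at 0)"
      by (intro tendsto_intros)
    then have lim: "((\<lambda>h. fact (j + 2) * \<bar>h\<bar> :: real) \<longlongrightarrow> 0) (at 0)" by simp
    have "((\<lambda>h. flat_exp j h / h) \<longlongrightarrow> 0) (at 0)"
    proof (rule Lim_null_comparison[OF _ lim])
      have "norm (flat_exp j h / h) \<le> fact (j + 2) * \<bar>h\<bar>" if "h \<noteq> 0" for h
        using abs_flat_exp_le[of j h] that
        by (simp add: divide_le_eq power2_eq_square mult.assoc)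
      then show "\<forall>\<^sub>F h in at 0. norm (flat_exp j h / h) \<le> fact (j + 2) * \<bar>h\<bar>"
        by (auto simp: eventually_at_filter)
    qed
    then show ?thesis
      using 3 by (simp add: DERIV_def flat_exp_def[of _ 0])
  qed
qed

text \<open>Smoothness of test functions means that every iterate of \<open>deriv\<close> is
  differentiable. A class closed under \<open>deriv\<close> yields this by induction, without a
  formula for the iterates; the index \<open>j\<close> of \<open>flat_exp\<close> is there to make
  the class closed.\<close>

inductive flat_algebra :: "(real \<Rightarrow> real) \<Rightarrow> bool" where
  flat_exp: "flat_algebra (\<lambda>x. flat_exp j (c * x + d))"
| const: "flat_algebra (\<lambda>x. c)"
| add: "flat_algebra f \<Longrightarrow> flat_algebra g \<Longrightarrow> flat_algebra (\<lambda>x. f x + g x)"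
| mult: "flat_algebra f \<Longrightarrow> flat_algebra g \<Longrightarrow> flat_algebra (\<lambda>x. f x * g x)"

lemma flat_algebra_derivative:
  assumes "flat_algebra f"
  obtains f' where "flat_algebra f'" "\<And>x. (f has_real_derivative f' x) (at x)"
proof -
  from assms have "\<exists>f'. flat_algebra f' \<and> (\<forall>x. (f has_real_derivative f' x) (at x))"
  proof induction
    case (flat_exp j c d)
    let ?f' = "\<lambda>x. (flat_exp (j + 2) (c * x + d) + (- real j) * flat_exp (j + 1) (c * x + d)) * c"
    have "flat_algebra ?f'"
      by (intro flat_algebra.intros)
    moreover have "((\<lambda>x. flat_exp j (c * x + d)) has_real_derivative ?f' x) (at x)" for x
      by (rule DERIV_chain2[OF has_real_derivative_flat_exp, THEN DERIV_cong])
         (auto intro!: derivative_eq_intros)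
    ultimately show ?case by blast
  next
    case (const c)
    show ?case by (intro exI[of _ "\<lambda>_. 0"]) (auto intro: flat_algebra.const)
  next
    case (add f g)
    then obtain f' g' where "flat_algebra f'" "flat_algebra g'"
      "\<forall>x. (f has_real_derivative f' x) (at x)" "\<forall>x. (g has_real_derivative g' x) (at x)" by blast
    then show ?case
      by (intro exI[of _ "\<lambda>x. f' x + g' x"]) (auto intro!: flat_algebra.add derivative_intros)
  next
    case (mult f g)
    then obtain f' g' where *: "flat_algebra f'" "flat_algebra g'"
      "\<forall>x. (f has_real_derivative f' x) (at x)" "\<forall>x. (g has_real_derivative g' x) (at x)" by blast
    then show ?case using mult.hyps
      by (intro exI[of _ "\<lambda>x. f' x * g x + g' x * f x"])
         (auto intro!: flat_algebra.add flat_algebra.mult DERIV_mult)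
  qed
  then show thesis using that by blast
qed

lemma flat_algebra_deriv: "flat_algebra f \<Longrightarrow> flat_algebra (deriv f)"
  by (metis DERIV_imp_deriv ext flat_algebra_derivative)

lemma flat_algebra_differentiable: "flat_algebra f \<Longrightarrow> f differentiable (at x)"
  by (metis flat_algebra_derivative real_differentiable_def)

lemma flat_algebra_funpow_deriv: "flat_algebra f \<Longrightarrow> flat_algebra ((deriv ^^ k) f)"
  by (induction k) (auto intro: flat_algebra_deriv)

text \<open>Membership in the algebra is asked of the derivative only, because the test functions of
  the du Bois-Reymond argument are primitives of members of the algebra.\<close>

lemma test_functionI:
  assumes \<psi>: "flat_algebra \<psi>" and deriv: "\<And>x. (\<phi> has_real_derivative \<psi> x) (at x)"
    and "0 < a" and supp: "\<And>x. x \<notin> {a..b} \<Longrightarrow> \<phi> x = 0"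
  shows "test_function \<phi>"
proof -
  have [simp]: "deriv \<phi> = \<psi>" using deriv by (auto intro: DERIV_imp_deriv)
  have "(deriv ^^ k) \<phi> differentiable (at x)" for k x
  proof (cases k)
    case 0
    then show ?thesis using deriv by (auto simp: real_differentiable_def)
  next
    case (Suc n)
    then show ?thesis
      using flat_algebra_differentiable[OF flat_algebra_funpow_deriv[OF \<psi>]]
      by (simp add: funpow_Suc_right del: funpow.simps)
  qed
  moreover have "closure {x. \<phi> x \<noteq> 0} \<subseteq> {a..b}"
    using supp by (intro closure_minimal) (auto simp del: atLeastAtMost_iff)
  moreover from this have "compact (closure {x. \<phi> x \<noteq> 0})"
    using compact_Int_closed[of "{a..b}" "closure {x. \<phi> x \<noteq> 0}"]
    by (simp add: Int_absorb1)
  ultimately show ?thesis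
    using \<open>0 < a\<close> unfolding test_function_def by fastforce
qed

lemma test_functionE:
  assumes "test_function \<phi>"
  obtains a b where "0 < a" "a < b" "\<And>x. x \<notin> {a..b} \<Longrightarrow> \<phi> x = 0" "\<And>x. x \<notin> {a..b} \<Longrightarrow> deriv \<phi> x = 0"
    "\<And>x. (\<phi> has_real_derivative deriv \<phi> x) (at x)" "continuous_on UNIV (deriv \<phi>)"
proof -
  let ?S = "closure {x. \<phi> x \<noteq> 0}"
  from assms have S: "compact ?S" "?S \<subseteq> {0<..}"
    and diff: "\<And>k x. (deriv ^^ k) \<phi> differentiable (at x)" by (auto simp: test_function_def)
  obtain a b where ab: "0 < a" "a < b" "?S \<subseteq> {a..b}"
  proof (cases "?S = {}")
    case True
    then show ?thesis using that[of 1 2] by auto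
  next
    case False
    then have "Inf ?S \<in> ?S" using S by (simp add: closed_contains_Inf bounded_imp_bdd_below compact_imp_bounded)
    moreover have "?S \<subseteq> {Inf ?S..Sup ?S + 1}"
    proof
      fix x assume "x \<in> ?S"
      then show "x \<in> {Inf ?S..Sup ?S + 1}"
        using cInf_lower[of x ?S] cSup_upper[of x ?S] S
        by (fastforce simp: bounded_imp_bdd_below bounded_imp_bdd_above compact_imp_bounded)
    qed
    moreover have "Inf ?S \<le> Sup ?S"
      using \<open>Inf ?S \<in> ?S\<close> S by (simp add: cSup_upper bounded_imp_bdd_above compact_imp_bounded)
    then have "Inf ?S < Sup ?S + 1" by simp
    moreover have "0 < Inf ?S"
      using \<open>Inf ?S \<in> ?S\<close> S(2) by auto
    ultimately show ?thesis using that[of "Inf ?S" "Sup ?S + 1"] by blast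
  qed
  have D: "(\<phi> has_real_derivative deriv \<phi> x) (at x)" for x
    using diff[of 0 x] by (simp add: DERIV_deriv_iff_real_differentiable)
  have 0: "\<phi> x = 0" if "x \<notin> {a..b}" for x
    using that ab closure_subset[of "{x. \<phi> x \<noteq> 0}"] by auto
  have "deriv \<phi> x = 0" if x: "x \<notin> {a..b}" for x
  proof -
    have "((\<lambda>x. 0) has_real_derivative 0) (at x)" by simp
    then have "(\<phi> has_real_derivative 0) (at x)"
      by (rule has_field_derivative_transform_within_open[where S="- {a..b}"]) (use 0 x in auto)
    then show ?thesis by (rule DERIV_imp_deriv)
  qed
  moreover have "continuous_on UNIV (deriv \<phi>)"
    using diff[of 1] by (auto simp: continuous_on_eq_continuous_at intro: differentiable_imp_continuous_within)
  ultimately show thesis using that ab 0 D by metis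
qed

section \<open>Integrals against test functions and the fundamental lemma of the calculus of
  variations\<close>

lemma absolutely_integrable_iff_lebesgue_on:
  fixes f :: "real \<Rightarrow> real"
  assumes "S \<in> sets lebesgue"
  shows "integrable (lebesgue_on S) f \<longleftrightarrow> f absolutely_integrable_on S"
  using assms by (simp add: set_integrable_def integrable_restrict_space)

lemma AE_lebesgue_on_iff_negligible:
  fixes S :: "real set"
  assumes "S \<in> sets lebesgue"
  shows "(AE x in lebesgue_on S. P x) \<longleftrightarrow> negligible {x \<in> S. \<not> P x}"
  using assms
  by (simp add: AE_restrict_space_iff completion.AE_iff_null_sets negligible_iff_null_sets)

lemma LINT_half_line_eq_integral:
  fixes f :: "real \<Rightarrow> real"
  assumes "f absolutely_integrable_on {a..b}" "0 < a" "\<And>x. x \<notin> {a..b} \<Longrightarrow> f x = 0"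
  shows "integrable half_line f" "(LINT x|half_line. f x) = integral {a..b} f"
proof -
  have neg: "negligible {x \<in> {a..b} - {0<..}. f x \<noteq> 0}" "negligible {x \<in> {0<..} - {a..b}. f x \<noteq> 0}"
    by (rule negligible_subset[of "{}"]; use assms in auto)+
  have "f absolutely_integrable_on {0<..}"
    using absolutely_integrable_spike_set[OF assms(1) neg] .
  then show *: "integrable half_line f"
    by (simp add: absolutely_integrable_iff_lebesgue_on)
  have "integral {0<..} f = integral {a..b} f"
    by (rule integral_spike_set) (use neg in auto)
  then show "(LINT x|half_line. f x) = integral {a..b} f"
    using lebesgue_integral_eq_integral[OF *] by simp
qed

lemma locally_integrable_iff:
  "locally_integrable h \<longleftrightarrow> (\<forall>a b. 0 < a \<longrightarrow> h absolutely_integrable_on {a..b})"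
proof
  assume h: "locally_integrable h"
  show "\<forall>a b. 0 < a \<longrightarrow> h absolutely_integrable_on {a..b}"
  proof (intro allI impI)
    fix a b :: real assume "0 < a"
    then have "integrable (lebesgue_on {a..b}) h"
      using h by (simp add: locally_integrable_def subset_iff)
    then show "h absolutely_integrable_on {a..b}"
      by (simp add: absolutely_integrable_iff_lebesgue_on)
  qed
next
  assume h: "\<forall>a b. 0 < a \<longrightarrow> h absolutely_integrable_on {a..b}"
  show "locally_integrable h"
    unfolding locally_integrable_def
  proof (intro allI impI)
    fix K :: "real set" assume K: "compact K \<and> K \<subseteq> {0<..}"
    show "integrable (lebesgue_on K) h"
    proof (cases "K = {}")
      case False
      then have "Inf K \<in> K"
        using K by (simp add: closed_contains_Inf bounded_imp_bdd_below compact_imp_bounded compact_imp_closed)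
      then have "0 < Inf K" using K by auto
      then have "h absolutely_integrable_on {Inf K..Sup K}" using h by blast
      moreover have "K \<subseteq> {Inf K..Sup K}"
        using K by (auto intro!: cInf_lower cSup_upper simp: bounded_imp_bdd_below bounded_imp_bdd_above compact_imp_bounded)
      moreover have Kl: "K \<in> sets lebesgue" using K by (simp add: compact_imp_closed)
      ultimately have "h absolutely_integrable_on K"
        using set_integrable_subset by blast
      then show ?thesis using Kl by (simp add: absolutely_integrable_iff_lebesgue_on)
    qed simp
  qed
qed

text \<open>By Lebesgue differentiation \<open>h\<close> is, off a null set, the limit of its
  averages over shrinking intervals, and all these averages are 0.\<close>

lemma integral_intervals_zero_imp_negligible:
  fixes h :: "real \<Rightarrow> real"
  assumes int: "\<And>a b. h integrable_on {a..b}" and zero: "\<And>a b. integral {a..b} h = 0"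
  shows "negligible {x. h x \<noteq> 0}"
proof -
  obtain N where N: "negligible N" and lim: "\<And>x e. x \<notin> N \<Longrightarrow> 0 < e \<Longrightarrow>
      \<exists>d>0. \<forall>k. 0 < k \<and> k < d \<longrightarrow> norm (integral (cbox x (x + k *\<^sub>R One)) h /\<^sub>R k ^ DIM(real) - h x) < e"
    using integrable_ccontinuous_explicit[of h] int by (metis box_real(2))
  have "h x = 0" if x: "x \<notin> N" for x
  proof (rule ccontr)
    assume "h x \<noteq> 0"
    then have "\<exists>d::real>0. \<forall>k. 0 < k \<and> k < d \<longrightarrow> \<bar>h x\<bar> < \<bar>h x\<bar>"
      using lim[OF x, of "\<bar>h x\<bar>"] zero by simp
    then show False using dense by blast
  qed
  then show ?thesis by (intro negligible_subset[OF N]) auto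
qed

text \<open>Stretching the arguments by \<open>Suc n\<close> makes these smooth functions increase
  to the indicator of \<open>{a<..<b}\<close> while the support stays inside
  \<open>{a..b}\<close>.\<close>

definition bump :: "real \<Rightarrow> real \<Rightarrow> nat \<Rightarrow> real \<Rightarrow> real" where
  "bump a b n x = flat_exp 0 (real (Suc n) * (x - a)) * flat_exp 0 (real (Suc n) * (b - x))"

lemma flat_algebra_bump: "flat_algebra (bump a b n)"
proof -
  have "flat_algebra (\<lambda>x. flat_exp 0 (real (Suc n) * x + (- real (Suc n) * a)) *
      flat_exp 0 (- real (Suc n) * x + real (Suc n) * b))"
    by (intro flat_algebra.intros)
  moreover have "(\<lambda>x. flat_exp 0 (real (Suc n) * x + (- real (Suc n) * a)) *
      flat_exp 0 (- real (Suc n) * x + real (Suc n) * b)) = bump a b n"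
    by (simp add: bump_def fun_eq_iff algebra_simps)
  ultimately show ?thesis by simp
qed

lemma bump_eq: "bump a b n x =
    (if a < x \<and> x < b then exp (- (1 / (x - a) + 1 / (b - x)) / real (Suc n)) else 0)"
proof (cases "a < x \<and> x < b")
  case True
  then have "real (Suc n) * (x - a) > 0" "real (Suc n) * (b - x) > 0" by auto
  then show ?thesis using True
    unfolding bump_def flat_exp_def
    by (simp add: exp_add[symmetric] divide_simps del: of_nat_Suc)
qed (auto simp: bump_def flat_exp_def zero_less_mult_iff)

lemma test_function_bump: "0 < a \<Longrightarrow> test_function (bump a b n)"
  by (rule test_functionI[of "deriv (bump a b n)" _ a b])
     (auto simp: bump_eq intro!: flat_algebra_deriv flat_algebra_bump flat_algebra_differentiable
       simp: DERIV_deriv_iff_real_differentiable)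

lemma bump_tendsto: "(\<lambda>n. bump a b n x) \<longlonglongrightarrow> (if a < x \<and> x < b then 1 else 0)"
proof (cases "a < x \<and> x < b")
  case True
  have "(\<lambda>n. exp (- (1 / (x - a) + 1 / (b - x)) / real (Suc n))) \<longlonglongrightarrow> exp 0"
    by (intro tendsto_exp LIMSEQ_Suc lim_const_over_n)
  then show ?thesis using True by (simp add: bump_eq del: of_nat_Suc)
qed (auto simp: bump_eq)

lemma abs_bump_le_1: "\<bar>bump a b n x\<bar> \<le> 1"
proof (cases "a < x \<and> x < b")
  case True
  then have "0 \<le> (1 / (x - a) + 1 / (b - x)) / real (Suc n)" by simp
  then show ?thesis using True by (simp only: bump_eq if_P minus_divide_left[symmetric] exp_minus) (simp add: inverse_le_1_iff)
qed (auto simp: bump_eq)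

lemma continuous_on_bump: "continuous_on S (bump a b n)"
  by (meson continuous_at_imp_continuous_on differentiable_imp_continuous_within flat_algebra_bump flat_algebra_differentiable)

lemma absolutely_integrable_mult_continuous:
  fixes h :: "real \<Rightarrow> real"
  assumes "h absolutely_integrable_on {a..b}" "continuous_on {a..b} \<phi>"
  shows "(\<lambda>x. h x * \<phi> x) absolutely_integrable_on {a..b}"
proof -
  have "(\<lambda>x. \<phi> x * h x) absolutely_integrable_on {a..b}"
    by (intro absolutely_integrable_bounded_measurable_product_real assms
          continuous_imp_measurable_on_sets_lebesgue compact_imp_bounded compact_continuous_image) auto
  then show ?thesis by (simp add: mult.commute)
qed

text \<open>Dominated convergence along \<open>bump a b n\<close> upgrades the hypothesis to
  vanishing integrals of \<open>h\<close> over every \<open>{a..b}\<close> with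
  \<open>0 < a\<close>.\<close>

lemma fundamental_lemma:
  assumes h: "locally_integrable h"
    and zero: "\<And>a b n. 0 < a \<Longrightarrow> (LINT x|half_line. h x * bump a b n x) = 0"
  shows "AE x in half_line. h x = 0"
proof -
  have zero': "integral {a..b} h = 0" if "0 < a" for a b
  proof -
    have ai: "h absolutely_integrable_on {a..b}"
      using h that by (simp add: locally_integrable_iff)
    let ?g = "\<lambda>x. h x * (if a < x \<and> x < b then 1 else 0)"
    have "(\<lambda>n. integral {a..b} (\<lambda>x. h x * bump a b n x)) \<longlonglongrightarrow> integral {a..b} ?g"
    proof (rule dominated_convergence)
      show "(\<lambda>x. h x * bump a b n x) integrable_on {a..b}" for n
        using absolutely_integrable_mult_continuous[OF ai continuous_on_bump]
        by (simp add: absolutely_integrable_on_def)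
      show "(\<lambda>x. \<bar>h x\<bar>) integrable_on {a..b}"
        using ai by (simp add: absolutely_integrable_on_def)
      show "norm (h x * bump a b n x) \<le> \<bar>h x\<bar>" for n x
        using abs_bump_le_1 by (simp add: abs_mult mult_left_le)
      show "(\<lambda>n. h x * bump a b n x) \<longlonglongrightarrow> ?g x" for x
        by (intro tendsto_intros bump_tendsto)
    qed
    moreover have "integral {a..b} (\<lambda>x. h x * bump a b n x) = 0" for n
    proof -
      have "(LINT x|half_line. h x * bump a b n x) = integral {a..b} (\<lambda>x. h x * bump a b n x)"
        by (rule LINT_half_line_eq_integral[OF absolutely_integrable_mult_continuous[OF ai continuous_on_bump] that])
           (auto simp: bump_eq)
      then show ?thesis using zero[OF that] by simp
    qed
    ultimately have "integral {a..b} ?g = 0"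
      by (simp add: LIMSEQ_const_iff)
    moreover have "integral {a..b} ?g = integral {a..b} h"
      by (rule integral_spike[of "{a, b}"]) auto
    ultimately show ?thesis by simp
  qed
  \<comment> \<open>Integrability is known only away from 0, whereas the differentiation argument
    asks for all intervals of the line. So \<open>h\<close> is cut off at \<open>1 / Suc n\<close>,
    and the countably many null sets are joined.\<close>
  have "negligible {x. (if 1 / real (Suc n) \<le> x then h x else 0) \<noteq> 0}" for n
  proof (rule integral_intervals_zero_imp_negligible)
    fix a b :: real
    let ?d = "1 / real (Suc n)" and ?f = "\<lambda>x. if 1 / real (Suc n) \<le> x then h x else 0"
    have "?f = (\<lambda>x. if x \<in> {?d..} then h x else 0)" by auto
    moreover have "(h has_integral 0) ({a..b} \<inter> {?d..})"
    proof -
      have "h integrable_on {max a ?d..b}" "integral {max a ?d..b} h = 0"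
        using h zero'[of "max a ?d" b] 
        by (auto simp: locally_integrable_iff absolutely_integrable_on_def less_max_iff_disj)
      moreover have "{a..b} \<inter> {?d..} = {max a ?d..b}" by auto
      ultimately show ?thesis by (metis integrable_integral)
    qed
    ultimately have "(?f has_integral 0) {a..b}"
      by (simp only: has_integral_restrict_Int Int_commute)
    then show "?f integrable_on {a..b}" "integral {a..b} ?f = 0"
      by blast+
  qed
  then have "negligible (\<Union>n. {x. (if 1 / real (Suc n) \<le> x then h x else 0) \<noteq> 0})"
    by (rule negligible_Union_nat)
  moreover have "{x \<in> {0<..}. h x \<noteq> 0} \<subseteq> (\<Union>n. {x. (if 1 / real (Suc n) \<le> x then h x else 0) \<noteq> 0})"
  proof
    fix x assume x: "x \<in> {x \<in> {0<..}. h x \<noteq> 0}"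
    then obtain n where "1 / real (Suc n) < x"
      using nat_approx_posE by auto
    then show "x \<in> (\<Union>n. {x. (if 1 / real (Suc n) \<le> x then h x else 0) \<noteq> 0})" using x by (auto intro!: exI[of _ n])
  qed
  ultimately have "negligible {x \<in> {0<..}. h x \<noteq> 0}"
    using negligible_subset by blast
  then show ?thesis by (simp add: AE_lebesgue_on_iff_negligible)
qed

text \<open>A bump minus a suitable multiple of the fixed bump \<open>?\<psi>\<close> has integral
  0, so its primitive has compact support and may be used as a test function. Testing with it shows
  that \<open>h - c\<close> is orthogonal to every bump, where \<open>c\<close> is the mean of
  \<open>h\<close> with weight \<open>?\<psi>\<close>.\<close>

lemma du_Bois_Reymond:
  assumes h: "locally_integrable h"
    and zero: "\<And>\<phi>. test_function \<phi> \<Longrightarrow> (LINT x|half_line. h x * deriv \<phi> x) = 0"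
  shows "\<exists>c. AE x in half_line. h x = c"
proof -
  let ?\<psi> = "bump 1 2 0"
  define I where "I = (LINT x|half_line. ?\<psi> x)"
  define c where "c = (LINT x|half_line. h x * ?\<psi> x) / I"
  have bump_int: "(LINT x|half_line. g x * bump a b n x) = integral {A..B} (\<lambda>x. g x * bump a b n x)"
      "(\<lambda>x. g x * bump a b n x) absolutely_integrable_on {A..B}"
      "integrable half_line (\<lambda>x. g x * bump a b n x)"
    if "0 < A" "A \<le> a" "b \<le> B" "locally_integrable g" for g A B a b n
  proof -
    show ai: "(\<lambda>x. g x * bump a b n x) absolutely_integrable_on {A..B}"
      using that by (intro absolutely_integrable_mult_continuous continuous_on_bump)
        (auto simp: locally_integrable_iff)
    have supp: "g x * bump a b n x = 0" if "x \<notin> {A..B}" for x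
      using that \<open>A \<le> a\<close> \<open>b \<le> B\<close> by (auto simp: bump_eq)
    show "(LINT x|half_line. g x * bump a b n x) = integral {A..B} (\<lambda>x. g x * bump a b n x)"
      by (rule LINT_half_line_eq_integral(2)[OF ai \<open>0 < A\<close> supp])
    show "integrable half_line (\<lambda>x. g x * bump a b n x)"
      by (rule LINT_half_line_eq_integral(1)[OF ai \<open>0 < A\<close> supp])
  qed
  have one: "locally_integrable (\<lambda>x. c)" for c
    by (auto simp: locally_integrable_iff intro: absolutely_integrable_continuous_real)
  have "integral {1..2} ?\<psi> \<noteq> 0"
  proof -
    have "?\<psi> (3 / 2) \<noteq> 0" by (simp add: bump_eq)
    moreover have "0 \<le> ?\<psi> x" for x by (simp add: bump_eq)
    moreover have "3 / 2 \<in> {1..2::real}" by simp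
    ultimately show ?thesis
      using integral_eq_0_iff[OF continuous_on_bump, of 1 2 1 2 0] by fastforce
  qed
  then have I: "I \<noteq> 0"
    using bump_int(1)[of 1 1 2 2 "\<lambda>_. 1" 0, OF _ _ _ one] by (simp add: I_def)
  have "(LINT x|half_line. (h x - c) * bump a b n x) = 0" if "0 < a" for a b n
  proof -
    let ?\<eta> = "bump a b n"
    define J where "J = (LINT x|half_line. ?\<eta> x) / I"
    define \<xi> where "\<xi> x = ?\<eta> x + (- J) * ?\<psi> x" for x
    \<comment> \<open>Halving keeps \<open>{A..2 * A}\<close> free of both supports: the primitive
      can be based at \<open>A\<close>, and every point from \<open>2 * A\<close> on is interior to
      the range of integration.\<close>
    define A B where "A = min a 1 / 2" and "B = max b 2"
    have AB: "0 < A" "2 * A \<le> a" "2 * A \<le> 1" "b \<le> B" "2 \<le> B" "A \<le> a" "A \<le> 1"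
      using that by (auto simp: A_def B_def)
    have fl: "flat_algebra \<xi>"
      unfolding \<xi>_def by (intro flat_algebra.intros flat_algebra_bump)
    have cont: "continuous_on S \<xi>" for S
      by (meson fl continuous_at_imp_continuous_on differentiable_imp_continuous_within flat_algebra_differentiable)
    have \<xi>0: "\<xi> x = 0" if "x \<le> 2 * A \<or> B \<le> x" for x
      using that AB by (auto simp: \<xi>_def bump_eq)
    define \<Phi> where "\<Phi> x = integral {A..x} \<xi>" for x
    have int: "\<xi> integrable_on {x..y}" for x y
      by (intro integrable_continuous_interval cont)
    have \<Phi>_left: "\<Phi> x = 0" if "x \<le> 2 * A" for x
      unfolding \<Phi>_def by (rule integral_unique[OF has_integral_is_0]) (use that \<xi>0 in auto)
    have "\<Phi> B = 0"
    proof -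
      have "\<Phi> B = integral {A..B} ?\<eta> - J * integral {A..B} ?\<psi>"
        unfolding \<Phi>_def \<xi>_def
        by (subst Henstock_Kurzweil_Integration.integral_add) (auto intro!: integrable_continuous_interval continuous_intros continuous_on_bump)
      also have "\<dots> = 0"
        using bump_int(1)[of A a b B "\<lambda>_. 1" n, OF _ _ _ one] bump_int(1)[of A 1 2 B "\<lambda>_. 1" 0, OF _ _ _ one] AB I
        by (simp add: J_def I_def)
      finally show ?thesis .
    qed
    have \<Phi>_right: "\<Phi> x = 0" if "B \<le> x" for x
    proof -
      have "\<Phi> x = \<Phi> B + integral {B..x} \<xi>"
        unfolding \<Phi>_def using AB that by (intro Henstock_Kurzweil_Integration.integral_combine[symmetric] int) auto
      also have "integral {B..x} \<xi> = 0"
        by (rule integral_unique[OF has_integral_is_0]) (use \<xi>0 in auto)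
      finally show ?thesis using \<open>\<Phi> B = 0\<close> by simp
    qed
    have D: "(\<Phi> has_real_derivative \<xi> x) (at x)" for x
    proof (cases "x < 2 * A")
      case True
      have "((\<lambda>x. 0) has_real_derivative 0) (at x)" by simp
      then have "(\<Phi> has_real_derivative 0) (at x)"
        by (rule has_field_derivative_transform_within_open[where S="{..<2 * A}"]) (use True \<Phi>_left in auto)
      then show ?thesis using \<xi>0 True by simp
    next
      case False
      then have "(\<Phi> has_real_derivative \<xi> x) (at x within {A..x + 1})"
        unfolding \<Phi>_def using AB by (intro integral_has_real_derivative cont) auto
      moreover have "at x within {A..x + 1} = at x"
        using False AB by (intro at_within_interior) (auto simp: interior_atLeastAtMost_real)
      ultimately show ?thesis by simp
    qed
    have "test_function \<Phi>"
      by (rule test_functionI[OF fl D, of "2 * A" B]) (use AB \<Phi>_left \<Phi>_right in auto)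
    then have "(LINT x|half_line. h x * deriv \<Phi> x) = 0" by (rule zero)
    moreover have "deriv \<Phi> = \<xi>" using D by (auto intro: DERIV_imp_deriv)
    ultimately have "0 = (LINT x|half_line. h x * ?\<eta> x - J * (h x * ?\<psi> x))"
      by (simp add: \<xi>_def algebra_simps)
    also have "\<dots> = (LINT x|half_line. h x * ?\<eta> x) - J * (c * I)"
      using bump_int(3)[of A a b B h n] bump_int(3)[of A 1 2 B h 0] AB h I by (simp add: c_def)
    also have "J * (c * I) = (LINT x|half_line. c * ?\<eta> x)"
      using I by (simp add: J_def)
    also have "(LINT x|half_line. h x * ?\<eta> x) - (LINT x|half_line. c * ?\<eta> x)
        = (LINT x|half_line. (h x - c) * ?\<eta> x)"
      using bump_int(3)[of A a b B h n] bump_int(3)[of A a b B "\<lambda>_. c" n, OF _ _ _ one] AB h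
      by (subst Bochner_Integration.integral_diff[symmetric]) (auto simp: algebra_simps)
    finally show ?thesis by simp
  qed
  moreover have "locally_integrable (\<lambda>x. h x - c)"
    using h one[of c] by (auto simp: locally_integrable_iff intro: set_integral_diff)
  ultimately have "AE x in half_line. h x - c = 0" by (rule fundamental_lemma[rotated])
  then show ?thesis by auto
qed

section \<open>Primitives and the Sobolev space\<close>

text \<open>Absolute continuity of \<open>F\<close> with density \<open>f\<close>, stated through
  the integral so that pointwise differentiability never enters.\<close>

definition primitive_on :: "real \<Rightarrow> real \<Rightarrow> (real \<Rightarrow> real) \<Rightarrow> (real \<Rightarrow> real) \<Rightarrow> bool" where
  "primitive_on a b F f \<longleftrightarrow>
     f absolutely_integrable_on {a..b} \<and> (\<forall>x\<in>{a..b}. F x = F a + integral {a..x} f)"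

lemma primitive_onD:
  assumes "primitive_on a b F f"
  shows "f absolutely_integrable_on {a..b}" "f integrable_on {a..b}"
    and "\<And>x. x \<in> {a..b} \<Longrightarrow> integral {a..x} f = F x - F a"
proof -
  from assms have ai: "f absolutely_integrable_on {a..b}"
    and eq: "\<forall>x\<in>{a..b}. F x = F a + integral {a..x} f"
    unfolding primitive_on_def by blast+
  show "f absolutely_integrable_on {a..b}" by fact
  then show "f integrable_on {a..b}" unfolding absolutely_integrable_on_def by blast
  show "integral {a..x} f = F x - F a" if "x \<in> {a..b}" for x
    using bspec[OF eq that] by linarith
qed

lemma primitive_onI:
  assumes "f absolutely_integrable_on {a..b}"
    and "\<And>x. x \<in> {a..b} \<Longrightarrow> integral {a..x} f = F x - F a"
  shows "primitive_on a b F f"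
  unfolding primitive_on_def
proof (intro conjI ballI)
  fix x assume "x \<in> {a..b}"
  from assms(2)[OF this] show "F x = F a + integral {a..x} f" by linarith
qed fact

lemma primitive_on_continuous:
  assumes "primitive_on a b F f"
  shows "continuous_on {a..b} F"
proof -
  have "continuous_on {a..b} (\<lambda>x. F a + integral {a..x} f)"
    by (intro continuous_on_add continuous_on_const indefinite_integral_continuous_1 primitive_onD(2)[OF assms])
  moreover have "F a + integral {a..x} f = F x" if "x \<in> {a..b}" for x
    using primitive_onD(3)[OF assms that] by simp
  ultimately show ?thesis by (rule continuous_on_eq)
qed

lemma primitive_on_diff:
  assumes "primitive_on a b F f" "a \<le> c" "c \<le> d" "d \<le> b"
  shows "integral {c..d} f = F d - F c"
proof -
  have "f integrable_on {a..d}"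
    using assms(2-4) by (intro integrable_subinterval_real[OF primitive_onD(2)[OF assms(1)]]) auto
  from Henstock_Kurzweil_Integration.integral_combine[OF assms(2,3) this] show ?thesis
    using primitive_onD(3)[OF assms(1), of c] primitive_onD(3)[OF assms(1), of d] assms(2-4) by simp
qed

lemma primitive_on_subinterval:
  assumes "primitive_on a b F f" "a \<le> c" "d \<le> b"
  shows "primitive_on c d F f"
proof (rule primitive_onI)
  show "f absolutely_integrable_on {c..d}"
    by (rule set_integrable_subset[OF primitive_onD(1)[OF assms(1)]]) (use assms in auto)
  show "integral {c..x} f = F x - F c" if "x \<in> {c..d}" for x
    using primitive_on_diff[OF assms(1,2), of x] that assms(3) by auto
qed

lemma primitive_on_C1:
  assumes "\<And>x. x \<in> {a..b} \<Longrightarrow> (F has_real_derivative f x) (at x within {a..b})"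
    and "continuous_on {a..b} f"
  shows "primitive_on a b F f"
proof -
  have "integral {a..x} f = F x - F a" if "x \<in> {a..b}" for x
  proof (rule integral_unique, rule fundamental_theorem_of_calculus)
    fix y assume "y \<in> {a..x}"
    then have "(F has_real_derivative f y) (at y within {a..x})"
      using that by (intro DERIV_subset[OF assms(1)]) auto
    then show "(F has_vector_derivative f y) (at y within {a..x})"
      by (simp add: has_real_derivative_iff_has_vector_derivative)
  qed (use that in auto)
  then show ?thesis
    using assms(2) by (intro primitive_onI absolutely_integrable_continuous_real)
qed

text \<open>The defect \<open>err\<close> of the product rule is subadditive under subdivision,
  while the integral \<open>K\<close> of \<open>\<bar>f\<bar> + \<bar>g\<bar>\<close> is additive.
  Near each point continuity of \<open>F\<close> and \<open>G\<close> bounds the defect by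
  \<open>e * K\<close>; \<open>Bolzano\<close> carries the bound to the whole interval, and
  \<open>e\<close> tends to 0.\<close>

lemma primitive_on_mult:
  assumes F: "primitive_on a b F f" and G: "primitive_on a b G g"
  shows "primitive_on a b (\<lambda>x. F x * G x) (\<lambda>x. f x * G x + g x * F x)"
proof -
  let ?\<phi> = "\<lambda>x. f x * G x + g x * F x"
  have contF: "continuous_on {a..b} F" and contG: "continuous_on {a..b} G"
    using F G primitive_on_continuous by auto
  have f: "f absolutely_integrable_on {a..b}" and g: "g absolutely_integrable_on {a..b}"
    using F G primitive_onD(1) by auto
  have \<phi>: "?\<phi> absolutely_integrable_on {a..b}"
    by (intro set_integral_add absolutely_integrable_mult_continuous f g contF contG)
  have sub: "h integrable_on {c..d}" "(\<lambda>x. \<bar>h x\<bar>) integrable_on {c..d}"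
      "h absolutely_integrable_on {c..d}"
    if "h absolutely_integrable_on {a..b}" "a \<le> c" "d \<le> b" for h :: "real \<Rightarrow> real" and c d
  proof -
    show "h absolutely_integrable_on {c..d}" using that by (auto intro: set_integrable_subset)
    then show "h integrable_on {c..d}" "(\<lambda>x. \<bar>h x\<bar>) integrable_on {c..d}"
      by (auto simp: absolutely_integrable_on_def)
  qed
  define err where "err c d = \<bar>F d * G d - F c * G c - integral {c..d} ?\<phi>\<bar>" for c d
  define K where "K c d = integral {c..d} (\<lambda>x. \<bar>f x\<bar> + \<bar>g x\<bar>)" for c d
  have err: "err a x \<le> e * K a x" if "e > 0" "x \<in> {a..b}" for e x
  proof -
    define P where "P c d \<longleftrightarrow> a \<le> c \<longrightarrow> c \<le> d \<longrightarrow> d \<le> b \<longrightarrow> err c d \<le> e * K c d" for c d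
    have "P a x"
    proof (rule Bolzano[where P = P])
      show "a \<le> x" using that by simp
    next
      fix c d k assume P: "P c d" "P d k" "c \<le> d" "d \<le> k"
      show "P c k"
        unfolding P_def
      proof (intro impI)
        assume *: "a \<le> c" "c \<le> k" "k \<le> b"
        have "integral {c..k} ?\<phi> = integral {c..d} ?\<phi> + integral {d..k} ?\<phi>"
          using P(3,4) * by (intro Henstock_Kurzweil_Integration.integral_combine[symmetric] sub(1)[OF \<phi>]) auto
        moreover have "K c k = K c d + K d k"
          unfolding K_def
          using P(3,4) * by (intro Henstock_Kurzweil_Integration.integral_combine[symmetric] integrable_add sub(2)[OF f] sub(2)[OF g]) auto
        ultimately show "err c k \<le> e * K c k"
          using P * unfolding P_def err_def by (simp add: algebra_simps)
      qed
    next
      fix y assume y: "a \<le> y" "y \<le> x"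
      then have yb: "y \<in> {a..b}" using that by simp
      obtain d1 where d1: "d1 > 0" "\<And>z. z \<in> {a..b} \<Longrightarrow> dist z y < d1 \<Longrightarrow> dist (F z) (F y) < e / 2"
        using contF yb \<open>e > 0\<close> unfolding continuous_on_iff by (meson half_gt_zero)
      obtain d2 where d2: "d2 > 0" "\<And>z. z \<in> {a..b} \<Longrightarrow> dist z y < d2 \<Longrightarrow> dist (G z) (G y) < e / 2"
        using contG yb \<open>e > 0\<close> unfolding continuous_on_iff by (meson half_gt_zero)
      show "\<exists>d>0. \<forall>c k. c \<le> y \<and> y \<le> k \<and> k - c < d \<longrightarrow> P c k"
      proof (intro exI[of _ "min d1 d2"] conjI allI impI)
        show "0 < min d1 d2" using d1 d2 by simp
        fix c k assume ck: "c \<le> y \<and> y \<le> k \<and> k - c < min d1 d2"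
        show "P c k"
          unfolding P_def
        proof (intro impI)
          assume *: "a \<le> c" "c \<le> k" "k \<le> b"
          have close: "\<bar>F k - F z\<bar> \<le> e" "\<bar>G c - G z\<bar> \<le> e" if "z \<in> {c..k}" for z
          proof -
            have "dist (F z) (F y) < e / 2" "dist (F k) (F y) < e / 2"
              "dist (G z) (G y) < e / 2" "dist (G c) (G y) < e / 2"
              by (intro d1(2) d2(2); use that * ck in \<open>auto simp: dist_real_def\<close>)+
            then show "\<bar>F k - F z\<bar> \<le> e" "\<bar>G c - G z\<bar> \<le> e"
              unfolding dist_real_def by linarith+
          qed
          have fi: "f integrable_on {c..k}" "g integrable_on {c..k}" "?\<phi> integrable_on {c..k}"
            using * sub(1)[OF f] sub(1)[OF g] sub(1)[OF \<phi>] by auto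
          \<comment> \<open>With \<open>F\<close> frozen at the right end and \<open>G\<close> at
            the left end this splitting is exact, so the comparison with the integrand involves only
            oscillations of \<open>F\<close> and \<open>G\<close>.\<close>
          have "F k * G k - F c * G c = F k * (G k - G c) + G c * (F k - F c)"
            by (simp add: algebra_simps)
          also have "\<dots> = F k * integral {c..k} g + G c * integral {c..k} f"
            using primitive_on_diff[OF F, of c k] primitive_on_diff[OF G, of c k] * by simp
          also have "\<dots> = integral {c..k} (\<lambda>z. F k * g z + G c * f z)"
            using fi by (simp add: Henstock_Kurzweil_Integration.integral_add integrable_on_mult_right)
          finally have "F k * G k - F c * G c - integral {c..k} ?\<phi>
              = integral {c..k} (\<lambda>z. (F k * g z + G c * f z) - ?\<phi> z)"
            by (simp only: Henstock_Kurzweil_Integration.integral_diff[OF _ fi(3)]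
                integrable_add integrable_on_mult_right fi(1,2))
          also have "(\<lambda>z. (F k * g z + G c * f z) - ?\<phi> z) = (\<lambda>z. (F k - F z) * g z + (G c - G z) * f z)"
            by (auto simp: algebra_simps)
          finally have "err c k = norm (integral {c..k} (\<lambda>z. (F k - F z) * g z + (G c - G z) * f z))"
            by (simp add: err_def)
          also have "\<dots> \<le> integral {c..k} (\<lambda>z. e * (\<bar>f z\<bar> + \<bar>g z\<bar>))"
          proof (rule integral_norm_bound_integral)
            have "(\<lambda>z. (F k * g z + G c * f z) - ?\<phi> z) integrable_on {c..k}"
              by (intro integrable_diff[OF _ fi(3)] integrable_add integrable_on_mult_right fi(1,2))
            then show "(\<lambda>z. (F k - F z) * g z + (G c - G z) * f z) integrable_on {c..k}"
              by (simp add: algebra_simps)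
            show "(\<lambda>z. e * (\<bar>f z\<bar> + \<bar>g z\<bar>)) integrable_on {c..k}"
              using * by (intro integrable_on_mult_right integrable_add sub(2)[OF f] sub(2)[OF g])
            fix z assume z: "z \<in> {c..k}"
            have "norm ((F k - F z) * g z + (G c - G z) * f z) \<le> \<bar>F k - F z\<bar> * \<bar>g z\<bar> + \<bar>G c - G z\<bar> * \<bar>f z\<bar>"
              by (simp add: abs_mult[symmetric])
            also have "\<dots> \<le> e * \<bar>g z\<bar> + e * \<bar>f z\<bar>"
              using close[OF z] by (intro add_mono mult_right_mono) auto
            finally show "norm ((F k - F z) * g z + (G c - G z) * f z) \<le> e * (\<bar>f z\<bar> + \<bar>g z\<bar>)"
              by (simp add: algebra_simps)
          qed
          also have "\<dots> = e * K c k" by (simp add: K_def)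
          finally show "err c k \<le> e * K c k" .
        qed
      qed
    qed
    then show ?thesis using that by (simp add: P_def)
  qed
  have err0: "err a x = 0" if x: "x \<in> {a..b}" for x
  proof -
    have "((\<lambda>e. e * K a x) \<longlongrightarrow> 0 * K a x) (at_right 0)" by (intro tendsto_intros)
    then have "err a x \<le> 0 * K a x"
      by (rule tendsto_lowerbound) (use err x in \<open>auto simp: eventually_at_filter\<close>)
    then show ?thesis by (simp add: err_def)
  qed
  show ?thesis
  proof (rule primitive_onI[OF \<phi>])
    fix x assume "x \<in> {a..b}"
    from err0[OF this] show "integral {a..x} ?\<phi> = F x * G x - F a * G a"
      unfolding err_def by linarith
  qed
qed

text \<open>A Sobolev function given by its continuous representative, with a genuine value at 0,
  and one choice of derivative. The energy estimates are carried out on such pairs, away from the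
  choice operators in \<open>cont_rep\<close> and \<open>weak_deriv\<close>.\<close>

definition H1_pair :: "(real \<Rightarrow> real) \<Rightarrow> (real \<Rightarrow> real) \<Rightarrow> bool" where
  "H1_pair v g \<longleftrightarrow> (\<forall>X. primitive_on 0 X v g) \<and>
     (\<lambda>x. (v x)\<^sup>2) absolutely_integrable_on {0..} \<and> (\<lambda>x. (g x)\<^sup>2) absolutely_integrable_on {0..}"

section \<open>Translation between the measure \<open>half_line\<close> and gauge integrals over
  \<open>{0..}\<close>\<close>

lemma absolutely_integrable_half_line_iff:
  fixes f :: "real \<Rightarrow> real"
  shows "integrable half_line f \<longleftrightarrow> f absolutely_integrable_on {0..}"
proof -
  have "f absolutely_integrable_on {0<..} \<longleftrightarrow> f absolutely_integrable_on {0..}"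
    by (rule absolutely_integrable_spike_set_eq; rule negligible_subset[of "{0}"]) auto
  then show ?thesis by (simp add: absolutely_integrable_iff_lebesgue_on)
qed

lemma LINT_half_line:
  fixes f :: "real \<Rightarrow> real"
  assumes "f absolutely_integrable_on {0..}"
  shows "(LINT x|half_line. f x) = integral {0..} f"
proof -
  have "(LINT x|half_line. f x) = integral {0<..} f"
    using assms by (intro lebesgue_integral_eq_integral) (auto simp: absolutely_integrable_half_line_iff)
  also have "\<dots> = integral {0..} f"
    by (rule integral_spike_set; rule negligible_subset[of "{0}"]) auto
  finally show ?thesis .
qed

lemma borel_measurable_half_line_AE_cong:
  fixes f g :: "real \<Rightarrow> real"
  assumes "f \<in> borel_measurable half_line" and ae: "AE x in half_line. f x = g x"
  shows "g \<in> borel_measurable half_line"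
proof -
  have "(\<lambda>x. if x \<in> {0<..} then f x else 0) \<in> borel_measurable lebesgue"
    using assms by (subst borel_measurable_if) auto
  moreover have "AE x in lebesgue. x \<in> {0<..} \<longrightarrow> f x = g x"
    using ae by (simp add: AE_restrict_space_iff)
  then have "AE x in lebesgue. (if x \<in> {0<..} then f x else 0) = (if x \<in> {0<..} then g x else 0)"
    by eventually_elim simp
  ultimately have "(\<lambda>x. if x \<in> {0<..} then g x else 0) \<in> borel_measurable lebesgue"
    by (rule borel_measurable_AE)
  then show ?thesis by (rule borel_measurable_if_D)
qed

lemma L2_iff: "u \<in> L2 \<longleftrightarrow> u \<in> borel_measurable half_line \<and> (\<lambda>x. (u x)\<^sup>2) absolutely_integrable_on {0..}"
  by (simp add: L2_def absolutely_integrable_half_line_iff)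

lemma L2_AE_cong:
  assumes "f \<in> L2" "AE x in half_line. f x = g x"
  shows "g \<in> L2"
proof -
  have f: "f \<in> borel_measurable half_line" using assms(1) by (simp add: L2_def)
  have meas: "g \<in> borel_measurable half_line"
    by (rule borel_measurable_half_line_AE_cong[OF f assms(2)])
  moreover have "integrable half_line (\<lambda>x. \<bar>g x\<bar>\<^sup>2)"
  proof (rule integrable_cong_AE_imp[where g = "\<lambda>x. \<bar>f x\<bar>\<^sup>2"])
    show "integrable half_line (\<lambda>x. \<bar>f x\<bar>\<^sup>2)" using assms(1) by (simp add: L2_def)
    show "AE x in half_line. \<bar>f x\<bar>\<^sup>2 = \<bar>g x\<bar>\<^sup>2" using assms(2) by eventually_elim simp
  qed (use meas in simp)
  ultimately show ?thesis by (simp add: L2_def)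
qed

text \<open>This is \<open>2 * \<bar>g x\<bar> \<le> 1 + (g x) ^ 2\<close> on a bounded interval.
  That the interval may start at 0 is what gives the functions in \<open>H1\<close> a boundary
  value.\<close>

lemma L2_absolutely_integrable:
  assumes "g \<in> L2"
  shows "g absolutely_integrable_on {0..X}"
proof -
  have "g absolutely_integrable_on {0<..X}"
  proof (rule measurable_bounded_by_integrable_imp_absolutely_integrable)
    show "g \<in> borel_measurable (lebesgue_on {0<..X})"
      using assms by (auto simp: L2_def intro: measurable_restrict_mono)
    have "(\<lambda>x. (g x)\<^sup>2) absolutely_integrable_on {0<..X}"
      using assms by (auto simp: L2_iff intro: set_integrable_subset)
    then show "(\<lambda>x. 1 + (g x)\<^sup>2) integrable_on {0<..X}"
      by (intro integrable_add integrable_on_const bounded_set_imp_lmeasurable)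
        (auto simp: absolutely_integrable_on_def)
    fix x
    have "2 * \<bar>g x\<bar> \<le> 1 + (g x)\<^sup>2"
      using sum_squares_bound[of 1 "\<bar>g x\<bar>"] by simp
    then show "norm (g x) \<le> 1 + (g x)\<^sup>2" by simp
  qed simp
  moreover have "negligible {x \<in> {0<..X} - {0..X}. g x \<noteq> 0}" "negligible {x \<in> {0..X} - {0<..X}. g x \<noteq> 0}"
    by (rule negligible_subset[of "{0}"]; auto)+
  ultimately show ?thesis by (rule absolutely_integrable_spike_set)
qed

section \<open>Weak derivatives, primitives and continuous representatives\<close>

lemma has_weak_derivative_primitive:
  assumes "\<And>X. primitive_on 0 X v g"
  shows "has_weak_derivative v g"
proof -
  have v: "v absolutely_integrable_on {a..b}" and g: "g absolutely_integrable_on {a..b}" if "0 \<le> a" for a b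
    using primitive_on_subinterval[OF assms that order_refl, of b]
    by (blast intro: primitive_onD(1) absolutely_integrable_continuous_real primitive_on_continuous)+
  have "(LINT x|half_line. v x * deriv \<phi> x) = - (LINT x|half_line. g x * \<phi> x)" if "test_function \<phi>" for \<phi>
    using that
  proof (rule test_functionE)
    fix a b :: real assume ab: "0 < a" "a < b" and \<phi>: "\<And>x. x \<notin> {a..b} \<Longrightarrow> \<phi> x = 0"
      "\<And>x. x \<notin> {a..b} \<Longrightarrow> deriv \<phi> x = 0"
      and D: "\<And>x. (\<phi> has_real_derivative deriv \<phi> x) (at x)" and cont: "continuous_on UNIV (deriv \<phi>)"
    \<comment> \<open>The interval is enlarged on both sides so that \<open>\<phi>\<close> vanishes
      at its ends and integration by parts leaves no boundary terms.\<close>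
    define A B where "A = a / 2" and "B = b + 1"
    have AB: "0 < A" "A < a" "b < B" "A \<le> B" using ab by (auto simp: A_def B_def)
    have \<phi>p: "primitive_on A B \<phi> (deriv \<phi>)"
      by (rule primitive_on_C1) (use D cont in \<open>auto intro: has_field_derivative_at_within continuous_on_subset\<close>)
    have vp: "primitive_on A B v g"
      using primitive_on_subinterval[OF assms[of B], of A B] AB by simp
    have "integral {A..B} (\<lambda>x. g x * \<phi> x + deriv \<phi> x * v x) = 0"
      using primitive_on_diff[OF primitive_on_mult[OF vp \<phi>p], of A B] \<phi> AB by simp
    moreover have ai: "(\<lambda>x. g x * \<phi> x) absolutely_integrable_on {A..B}"
        "(\<lambda>x. v x * deriv \<phi> x) absolutely_integrable_on {A..B}"
      using AB v[of A B] g[of A B] primitive_on_continuous[OF \<phi>p] continuous_on_subset[OF cont, of "{A..B}"]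
      by (simp_all add: absolutely_integrable_mult_continuous)
    moreover have "(LINT x|half_line. g x * \<phi> x) = integral {A..B} (\<lambda>x. g x * \<phi> x)"
      by (rule LINT_half_line_eq_integral[OF ai(1)]) (use AB \<phi> in auto)
    moreover have "(LINT x|half_line. v x * deriv \<phi> x) = integral {A..B} (\<lambda>x. v x * deriv \<phi> x)"
      by (rule LINT_half_line_eq_integral[OF ai(2)]) (use AB \<phi> in auto)
    ultimately show ?thesis
      by (simp add: Henstock_Kurzweil_Integration.integral_add absolutely_integrable_on_def mult.commute)
  qed
  then show ?thesis
    using v g by (simp add: has_weak_derivative_def locally_integrable_iff)
qed

lemma integrable_mult_compact_support:
  assumes h: "locally_integrable h" and a: "0 < a" and cont: "continuous_on UNIV \<phi>"
    and supp: "\<And>x. x \<notin> {a..b} \<Longrightarrow> \<phi> x = 0"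
  shows "integrable half_line (\<lambda>x. h x * \<phi> x)"
proof -
  have "h absolutely_integrable_on {a..b}"
    using h a unfolding locally_integrable_iff by blast
  moreover have "continuous_on {a..b} \<phi>"
    using cont continuous_on_subset by blast
  ultimately have "(\<lambda>x. h x * \<phi> x) absolutely_integrable_on {a..b}"
    by (rule absolutely_integrable_mult_continuous)
  moreover have "h x * \<phi> x = 0" if "x \<notin> {a..b}" for x
    using supp[OF that] by simp
  ultimately show ?thesis
    using LINT_half_line_eq_integral(1) a by blast
qed

lemma weak_derivative_unique:
  assumes "has_weak_derivative u f" "has_weak_derivative u g"
  shows "AE x in half_line. f x = g x"
proof -
  have f: "locally_integrable f" and g: "locally_integrable g"
    using assms by (auto simp: has_weak_derivative_def)
  have "(LINT x|half_line. (f x - g x) * bump a b n x) = 0" if "0 < a" for a b n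
  proof -
    have int: "integrable half_line (\<lambda>x. h x * bump a b n x)" if "locally_integrable h" for h
      by (rule integrable_mult_compact_support[OF that \<open>0 < a\<close> continuous_on_bump, of b])
        (auto simp: bump_eq)
    have "(LINT x|half_line. f x * bump a b n x) = (LINT x|half_line. g x * bump a b n x)"
    proof -
      have "- (LINT x|half_line. f x * bump a b n x) = - (LINT x|half_line. g x * bump a b n x)"
        using assms test_function_bump[OF that, of b n] unfolding has_weak_derivative_def by auto
      then show ?thesis by linarith
    qed
    then show ?thesis
      using int f g by (simp add: left_diff_distrib)
  qed
  moreover have "locally_integrable (\<lambda>x. f x - g x)"
    using f g by (auto simp: locally_integrable_iff intro: set_integral_diff)
  ultimately have "AE x in half_line. f x - g x = 0" by (rule fundamental_lemma[rotated])
  then show ?thesis by simp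
qed

lemma weak_deriv_AE:
  assumes "has_weak_derivative u g"
  shows "AE x in half_line. weak_deriv u x = g x"
proof -
  have "has_weak_derivative u (weak_deriv u)"
    using someI[of "has_weak_derivative u", OF assms] by (simp add: weak_deriv_def)
  then show ?thesis using assms weak_derivative_unique by blast
qed

lemma continuous_AE_eq:
  fixes v w :: "real \<Rightarrow> real"
  assumes v: "continuous_on {0..} v" and w: "continuous_on {0..} w"
    and ae: "AE x in half_line. v x = w x" and "0 \<le> x"
  shows "v x = w x"
proof (rule ccontr)
  assume neq: "v x \<noteq> w x"
  have "continuous_on {0..} (\<lambda>x. \<bar>v x - w x\<bar>)" by (intro continuous_intros v w)
  then obtain d where d: "d > 0" "\<And>y. y \<in> {0..} \<Longrightarrow> dist y x < d \<Longrightarrow> dist \<bar>v y - w y\<bar> \<bar>v x - w x\<bar> < \<bar>v x - w x\<bar>"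
    using \<open>0 \<le> x\<close> neq unfolding continuous_on_iff
    by (meson atLeast_iff right_minus_eq zero_less_abs_iff)
  have "{x<..<x + d} \<subseteq> {x \<in> {0<..}. v x \<noteq> w x}"
  proof
    fix y assume y: "y \<in> {x<..<x + d}"
    then have "y \<in> {0..}" "dist y x < d" using \<open>0 \<le> x\<close> by (auto simp: dist_real_def)
    from d(2)[OF this] have "v y \<noteq> w y" by (auto simp: dist_real_def)
    then show "y \<in> {x \<in> {0<..}. v x \<noteq> w x}" using y \<open>0 \<le> x\<close> by simp
  qed
  moreover have "negligible {x \<in> {0<..}. v x \<noteq> w x}"
    using ae by (simp add: AE_lebesgue_on_iff_negligible)
  ultimately have "negligible {x<..<x + d}" using negligible_subset by blast
  then show False using open_not_negligible[of "{x<..<x + d}"] d(1) by auto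
qed

lemma cont_rep_eq:
  assumes "continuous_on {0..} v" "AE x in half_line. v x = u x"
  shows "continuous_on {0..} (cont_rep u)" "AE x in half_line. cont_rep u x = u x"
    and "\<And>x. 0 \<le> x \<Longrightarrow> cont_rep u x = v x"
proof -
  have *: "continuous_on {0..} (cont_rep u) \<and> (AE x in half_line. cont_rep u x = u x)"
    unfolding cont_rep_def by (rule someI[of _ v]) (use assms in auto)
  then show "continuous_on {0..} (cont_rep u)" "AE x in half_line. cont_rep u x = u x" by auto
  fix x :: real assume "0 \<le> x"
  moreover have "AE x in half_line. cont_rep u x = v x"
    using conjunct2[OF *] assms(2) by eventually_elim simp
  ultimately show "cont_rep u x = v x" using * assms(1) by (blast intro: continuous_AE_eq)
qed

lemma primitive_on_half_line_continuous:
  assumes "\<And>X. primitive_on 0 X v g"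
  shows "continuous_on {0..} v"
proof -
  have "continuous (at x within {0..}) v" if "0 \<le> x" for x
  proof -
    have "continuous (at x within {0..x + 1}) v"
      using primitive_on_continuous[OF assms[of "x + 1"]] that by (auto simp: continuous_on_eq_continuous_within)
    moreover have "at x within {0..x + 1} = at x within {0..}"
      by (rule at_within_nhd[of _ "{..<x + 1}"]) auto
    ultimately show ?thesis by simp
  qed
  then show ?thesis by (auto simp: continuous_on_eq_continuous_within)
qed

text \<open>The primitive \<open>w\<close> of the weak derivative has the same weak derivative as
  \<open>u\<close>, so by du Bois-Reymond \<open>u - w\<close> is almost everywhere a constant.
  Adding the constant to \<open>w\<close> gives the continuous representative.\<close>

lemma H1_pair_of_H1:
  assumes "u \<in> H1"
  shows "H1_pair (cont_rep u) (weak_deriv u)" "AE x in half_line. cont_rep u x = u x"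
proof -
  obtain g0 where g0: "g0 \<in> L2" "has_weak_derivative u g0" and u: "u \<in> L2"
    using assms by (auto simp: H1_def)
  define g where "g = weak_deriv u"
  have ug: "has_weak_derivative u g"
    using someI[of "has_weak_derivative u", OF g0(2)] by (simp add: g_def weak_deriv_def)
  have gL2: "g \<in> L2"
    using L2_AE_cong[OF g0(1) weak_derivative_unique[OF g0(2) ug]] .
  define w where "w x = integral {0..x} g" for x
  have w: "primitive_on 0 X w g" for X
    using L2_absolutely_integrable[OF gL2] by (intro primitive_onI) (auto simp: w_def)
  have wg: "has_weak_derivative w g" by (rule has_weak_derivative_primitive[OF w])
  have "\<exists>c. AE x in half_line. u x - w x = c"
  proof (rule du_Bois_Reymond)
    show "locally_integrable (\<lambda>x. u x - w x)"
      using ug wg by (auto simp: has_weak_derivative_def locally_integrable_iff intro: set_integral_diff)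
    fix \<phi> assume \<phi>: "test_function \<phi>"
    show "(LINT x|half_line. (u x - w x) * deriv \<phi> x) = 0"
      using \<phi>
    proof (rule test_functionE)
      fix a b :: real assume ab: "0 < a" and \<phi>0: "\<And>x. x \<notin> {a..b} \<Longrightarrow> deriv \<phi> x = 0"
        and cont: "continuous_on UNIV (deriv \<phi>)"
      have int: "integrable half_line (\<lambda>x. h x * deriv \<phi> x)" if "locally_integrable h" for h
        by (rule integrable_mult_compact_support[OF that ab cont \<phi>0])
      have "(LINT x|half_line. u x * deriv \<phi> x) = (LINT x|half_line. w x * deriv \<phi> x)"
        using ug wg \<phi> by (simp add: has_weak_derivative_def)
      then show ?thesis
        using int ug wg by (simp add: left_diff_distrib has_weak_derivative_def)
    qed
  qed
  then obtain c where c: "AE x in half_line. u x - w x = c" by blast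
  define v where "v x = c + w x" for x
  have v: "primitive_on 0 X v g" for X
    using primitive_onD[OF w[of X]] by (intro primitive_onI) (auto simp: v_def)
  have "AE x in half_line. v x = u x"
    using c by eventually_elim (simp add: v_def)
  note rep = cont_rep_eq[OF primitive_on_half_line_continuous[OF v] this]
  show ae: "AE x in half_line. cont_rep u x = u x" by (rule rep)
  have "primitive_on 0 X (cont_rep u) g" for X
    using primitive_onD[OF v[of X]] rep(3) by (intro primitive_onI) auto
  moreover have "AE x in half_line. u x = cont_rep u x"
    using ae by eventually_elim simp
  then have "cont_rep u \<in> L2" using L2_AE_cong[OF u] by blast
  ultimately show "H1_pair (cont_rep u) (weak_deriv u)"
    using gL2 by (simp add: H1_pair_def L2_iff g_def)
qed

lemma H1_pair_continuous: "H1_pair v g \<Longrightarrow> continuous_on {0..} v"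
  by (rule primitive_on_half_line_continuous[of v g]) (simp add: H1_pair_def)

lemma continuous_on_half_line_measurable:
  fixes f :: "real \<Rightarrow> real"
  assumes "continuous_on {0..} f"
  shows "f \<in> borel_measurable half_line"
  by (intro continuous_imp_measurable_on_sets_lebesgue continuous_on_subset[OF assms]) auto

lemma H1_of_H1_pair:
  assumes v: "H1_pair v g"
  shows "v \<in> H1" "\<And>x. 0 \<le> x \<Longrightarrow> cont_rep v x = v x" "AE x in half_line. weak_deriv v x = g x"
proof -
  have prim: "primitive_on 0 X v g" for X using v by (simp add: H1_pair_def)
  have weak: "has_weak_derivative v g" by (rule has_weak_derivative_primitive[OF prim])
  then show "AE x in half_line. weak_deriv v x = g x" by (rule weak_deriv_AE)
  show "0 \<le> x \<Longrightarrow> cont_rep v x = v x" for x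
    by (rule cont_rep_eq(3)[OF H1_pair_continuous[OF v]]) auto
  \<comment> \<open>A pair gives measurability of \<open>g\<close> only through integrability on
    bounded intervals, so \<open>g\<close> is recovered as the limit of its cutoffs.\<close>
  have "g \<in> borel_measurable half_line"
  proof -
    have m: "(\<lambda>x. if x \<in> {0..real n} then g x else 0) \<in> borel_measurable lebesgue" for n
      using absolutely_integrable_imp_borel_measurable[OF primitive_onD(1)[OF prim, of "real n"]]
      by (subst borel_measurable_if) auto
    have lim: "(\<lambda>n. if x \<in> {0..real n} then g x else 0) \<longlonglongrightarrow> (if x \<in> {0..} then g x else 0)" for x
    proof (rule tendsto_eventually)
      show "\<forall>\<^sub>F n in sequentially. (if x \<in> {0..real n} then g x else 0) = (if x \<in> {0..} then g x else 0)"
        using eventually_ge_at_top[of "nat \<lceil>x\<rceil>"] by eventually_elim (auto simp: nat_le_iff ceiling_le_iff)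
    qed
    have "(\<lambda>x. if x \<in> {0..} then g x else 0) \<in> borel_measurable lebesgue"
      by (rule borel_measurable_LIMSEQ_real[OF lim m])
    then have "g \<in> borel_measurable (lebesgue_on {0..})" by (rule borel_measurable_if_D)
    then show ?thesis by (rule measurable_restrict_mono) auto
  qed
  then show "v \<in> H1"
    using v weak continuous_on_half_line_measurable[OF H1_pair_continuous[OF v]]
    by (auto simp: H1_def L2_iff H1_pair_def)
qed

definition pair_energy :: "real \<Rightarrow> real \<Rightarrow> (real \<Rightarrow> real) \<Rightarrow> (real \<Rightarrow> real) \<Rightarrow> real" where
  "pair_energy p \<alpha> v g = 1 / 2 * integral {0..} (\<lambda>x. (g x)\<^sup>2)
     - 1 / p * integral {0..} (\<lambda>x. \<bar>v x\<bar> powr p) + \<alpha> / 2 * (v 0)\<^sup>2"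

lemma LINT_half_line_AE:
  fixes f h :: "real \<Rightarrow> real"
  assumes "f absolutely_integrable_on {0..}" and ae: "AE x in half_line. f x = h x"
  shows "(LINT x|half_line. h x) = integral {0..} f"
proof -
  have f: "f \<in> borel_measurable half_line"
    using assms(1) absolutely_integrable_half_line_iff by blast
  have "(LINT x|half_line. h x) = (LINT x|half_line. f x)"
  proof (rule integral_cong_AE)
    show "h \<in> borel_measurable half_line" by (rule borel_measurable_half_line_AE_cong[OF f ae])
    show "AE x in half_line. h x = f x" using ae by eventually_elim simp
  qed fact
  then show ?thesis using LINT_half_line[OF assms(1)] by simp
qed

section \<open>Tail integrals, decay and boundedness of Sobolev functions\<close>

lemma integral_Ici_split:
  fixes f :: "real \<Rightarrow> real"
  assumes f: "f absolutely_integrable_on {0..}" and x: "0 \<le> x"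
  shows "f absolutely_integrable_on {x..}" "f absolutely_integrable_on {0..x}"
    "integral {0..x} f + integral {x..} f = integral {0..} f"
proof -
  show 1: "f absolutely_integrable_on {x..}" "f absolutely_integrable_on {0..x}"
    by (rule set_integrable_subset[OF f]; use x in auto)+
  have "(f has_integral integral {0..x} f + integral {x..} f) ({0..x} \<union> {x..})"
  proof (rule has_integral_Un)
    show "(f has_integral integral {0..x} f) {0..x}" "(f has_integral integral {x..} f) {x..}"
      using 1 by (auto simp: absolutely_integrable_on_def)
    show "negligible ({0..x} \<inter> {x..})"
      by (rule negligible_subset[of "{x}"]) auto
  qed
  moreover have "{0..x} \<union> {x..} = {0..}" using x by auto
  ultimately show "integral {0..x} f + integral {x..} f = integral {0..} f"
    by (simp add: integral_unique)
qed

lemma integral_Icc_tendsto_Ici: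
  fixes f :: "real \<Rightarrow> real"
  assumes ai: "f absolutely_integrable_on {0..}"
  shows "((\<lambda>X. integral {0..X} f) \<longlongrightarrow> integral {0..} f) at_top"
proof -
  have "((\<lambda>X. LINT x:{0..X}|lebesgue. f x) \<longlongrightarrow> (LINT x:{0..}|lebesgue. f x)) at_top"
    by (rule tendsto_set_lebesgue_integral_at_top[OF _ ai]) auto
  then have "((\<lambda>X. LINT x:{0..X}|lebesgue. f x) \<longlongrightarrow> integral {0..} f) at_top"
    using ai by (simp add: set_lebesgue_integral_eq_integral)
  moreover have "\<forall>\<^sub>F X in at_top. (LINT x:{0..X}|lebesgue. f x) = integral {0..X} f"
    using eventually_ge_at_top[of 0]
    by eventually_elim (simp add: set_lebesgue_integral_eq_integral integral_Ici_split(2)[OF ai])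
  ultimately show ?thesis by (rule Lim_transform_eventually)
qed

text \<open>The optimal weight \<open>sqrt (e / m)\<close> degenerates for \<open>e = 0\<close>;
  \<open>\<theta> = s / (2 * m)\<close> leads to the same constant. For \<open>m = 0\<close> a large
  \<open>\<theta>\<close> contradicts \<open>s > 0\<close>.\<close>

lemma le_prod_of_weighted_bound:
  fixes s m e :: real
  assumes "0 \<le> s" "0 \<le> m" "0 \<le> e" and bound: "\<And>\<theta>. 0 < \<theta> \<Longrightarrow> s \<le> \<theta> * m + e / \<theta>"
  shows "s\<^sup>2 \<le> 4 * m * e"
proof (cases "s = 0")
  case False
  then have s: "s > 0" using assms by simp
  show ?thesis
  proof (cases "m = 0")
    case True
    have "s \<le> e / (2 * (e + 1) / s)"
      using bound[of "2 * (e + 1) / s"] True s assms by simp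
    also have "\<dots> = s * (e / (2 * (e + 1)))" by simp
    also have "\<dots> < s * 1" using s assms by (intro mult_strict_left_mono) auto
    finally show ?thesis by simp
  next
    case False
    then have m: "m > 0" using assms by simp
    have "s \<le> s / (2 * m) * m + e / (s / (2 * m))" using bound[of "s / (2 * m)"] m s by simp
    then show ?thesis using m s by (simp add: field_simps power2_eq_square)
  qed
qed (use assms in simp)


lemma H1_pairD:
  assumes "H1_pair v g"
  shows "primitive_on 0 X v g" "(\<lambda>x. (v x)\<^sup>2) absolutely_integrable_on {0..}"
    "(\<lambda>x. (g x)\<^sup>2) absolutely_integrable_on {0..}"
  using assms by (auto simp: H1_pair_def)

lemma integral_Icc_le_Ici:
  fixes f :: "real \<Rightarrow> real"
  assumes f: "f absolutely_integrable_on {0..}" and "0 \<le> x" and nonneg: "\<And>x. 0 \<le> f x"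
  shows "integral {x..y} f \<le> integral {x..} f"
proof (rule integral_subset_le)
  have "f absolutely_integrable_on {x..y}"
    by (rule set_integrable_subset[OF f]) (use \<open>0 \<le> x\<close> in auto)
  then show "f integrable_on {x..y}" by (simp add: absolutely_integrable_on_def)
  show "f integrable_on {x..}"
    using integral_Ici_split(1)[OF f \<open>0 \<le> x\<close>] by (simp add: absolutely_integrable_on_def)
qed (use nonneg in auto)

text \<open>A substitute for decay at infinity that rests on square integrability alone; it lets the
  far end of an interval be discarded up to \<open>e\<close>.\<close>

lemma H1_pair_arbitrarily_small:
  assumes v: "H1_pair v g" and x: "0 \<le> x" and e: "e > 0"
  obtains y where "x \<le> y" "(v y)\<^sup>2 < e"
proof -
  have "\<exists>y\<ge>x. (v y)\<^sup>2 < e"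
  proof (rule ccontr)
    assume "\<not> (\<exists>y\<ge>x. (v y)\<^sup>2 < e)"
    then have ge: "e \<le> (v y)\<^sup>2" if "x \<le> y" for y using that by force
    define K where "K = integral {x..} (\<lambda>x. (v x)\<^sup>2)"
    have ai: "(\<lambda>x. (v x)\<^sup>2) absolutely_integrable_on {0..}" by (rule H1_pairD(2)[OF v])
    have "0 \<le> K" unfolding K_def by (rule Henstock_Kurzweil_Integration.integral_nonneg)
      (use integral_Ici_split(1)[OF ai x] in \<open>auto simp: absolutely_integrable_on_def\<close>)
    define L where "L = (K + 1) / e"
    have L: "0 \<le> L" using e \<open>0 \<le> K\<close> by (simp add: L_def)
    have "K + 1 = integral {x..x + L} (\<lambda>_. e)"
      using L e by (simp add: L_def)
    also have "\<dots> \<le> integral {x..x + L} (\<lambda>x. (v x)\<^sup>2)"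
    proof (rule integral_le)
      have "(\<lambda>x. (v x)\<^sup>2) absolutely_integrable_on {x..x + L}"
        by (rule set_integrable_subset[OF ai]) (use x in auto)
      then show "(\<lambda>x. (v x)\<^sup>2) integrable_on {x..x + L}" by (simp add: absolutely_integrable_on_def)
    qed (use ge in auto)
    also have "\<dots> \<le> K" unfolding K_def by (rule integral_Icc_le_Ici[OF ai x]) simp
    finally show False by simp
  qed
  then show thesis using that by blast
qed

text \<open>Integrate the derivative \<open>2 * g * v\<close> of the square from \<open>x\<close> to
  a far point where \<open>v\<close> is small, and apply Young's inequality with weight
  \<open>\<theta>\<close>.\<close>

lemma H1_pair_weighted_bound:
  assumes v: "H1_pair v g" and x: "0 \<le> x" and \<theta>: "0 < \<theta>"
  shows "(v x)\<^sup>2 \<le> \<theta> * integral {x..} (\<lambda>x. (v x)\<^sup>2) + integral {x..} (\<lambda>x. (g x)\<^sup>2) / \<theta>"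
proof (rule field_le_epsilon)
  fix e :: real assume "0 < e"
  then obtain y where y: "x \<le> y" "(v y)\<^sup>2 < e" by (rule H1_pair_arbitrarily_small[OF v x])
  note ai = H1_pairD(2,3)[OF v]
  have sub: "(\<lambda>x. (v x)\<^sup>2) integrable_on {x..y}" "(\<lambda>x. (g x)\<^sup>2) integrable_on {x..y}"
    using ai[THEN set_integrable_subset, of "{x..y}"] x by (auto simp: absolutely_integrable_on_def)
  have pr: "primitive_on x y (\<lambda>z. v z * v z) (\<lambda>z. g z * v z + g z * v z)"
    by (rule primitive_on_subinterval[OF primitive_on_mult[OF H1_pairD(1)[OF v] H1_pairD(1)[OF v]] x order_refl])
  have "integral {x..y} (\<lambda>z. g z * v z + g z * v z) = v y * v y - v x * v x"
    by (rule primitive_onD(3)[OF pr]) (use y in auto)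
  moreover have "integral {x..y} (\<lambda>z. - (g z * v z + g z * v z))
      \<le> integral {x..y} (\<lambda>z. \<theta> * (v z)\<^sup>2 + (g z)\<^sup>2 / \<theta>)"
  proof (rule integral_le)
    show "(\<lambda>z. - (g z * v z + g z * v z)) integrable_on {x..y}"
      by (rule integrable_neg[OF primitive_onD(2)[OF pr]])
    show "(\<lambda>z. \<theta> * (v z)\<^sup>2 + (g z)\<^sup>2 / \<theta>) integrable_on {x..y}"
      by (intro integrable_add integrable_on_mult_right integrable_on_divide sub)
    fix z
    have "0 \<le> (\<theta> * v z + g z)\<^sup>2 / \<theta>" using \<theta> by simp
    also have "\<dots> = \<theta> * (v z)\<^sup>2 + (g z)\<^sup>2 / \<theta> + (g z * v z + g z * v z)"
      using \<theta> by (simp add: field_simps power2_eq_square)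
    finally show "- (g z * v z + g z * v z) \<le> \<theta> * (v z)\<^sup>2 + (g z)\<^sup>2 / \<theta>" by simp
  qed
  moreover have "integral {x..y} (\<lambda>z. \<theta> * (v z)\<^sup>2 + (g z)\<^sup>2 / \<theta>)
      = \<theta> * integral {x..y} (\<lambda>z. (v z)\<^sup>2) + integral {x..y} (\<lambda>z. (g z)\<^sup>2) / \<theta>"
    using sub by (simp add: Henstock_Kurzweil_Integration.integral_add integrable_on_mult_right integrable_on_divide)
  moreover have "\<theta> * integral {x..y} (\<lambda>z. (v z)\<^sup>2) \<le> \<theta> * integral {x..} (\<lambda>z. (v z)\<^sup>2)"
    using \<theta> integral_Icc_le_Ici[OF ai(1) x] by simp
  moreover have "integral {x..y} (\<lambda>z. (g z)\<^sup>2) / \<theta> \<le> integral {x..} (\<lambda>z. (g z)\<^sup>2) / \<theta>"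
    using \<theta> integral_Icc_le_Ici[OF ai(2) x] by (simp add: divide_right_mono)
  ultimately show "(v x)\<^sup>2 \<le> \<theta> * integral {x..} (\<lambda>x. (v x)\<^sup>2) + integral {x..} (\<lambda>x. (g x)\<^sup>2) / \<theta> + e"
    using y(2) by (simp add: power2_eq_square)
qed

lemma integral_Ici_nonneg:
  fixes f :: "real \<Rightarrow> real"
  assumes f: "f absolutely_integrable_on {0..}" and "0 \<le> x" and nonneg: "\<And>x. 0 \<le> f x"
  shows "0 \<le> integral {x..} f"
  using integral_Icc_le_Ici[OF assms, of x] by simp

text \<open>Both tails start at \<open>x\<close>, and the constant 4 is sharp, with equality for
  \<open>exp (- c * x)\<close>, \<open>c > 0\<close>. This precise form pays for the boundary term
  of the calibration.\<close>

lemma H1_pair_decay: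
  assumes v: "H1_pair v g" and x: "0 \<le> x"
  shows "(v x) ^ 4 \<le> 4 * integral {x..} (\<lambda>x. (v x)\<^sup>2) * integral {x..} (\<lambda>x. (g x)\<^sup>2)"
proof -
  have "((v x)\<^sup>2)\<^sup>2 \<le> 4 * integral {x..} (\<lambda>x. (v x)\<^sup>2) * integral {x..} (\<lambda>x. (g x)\<^sup>2)"
    by (rule le_prod_of_weighted_bound)
      (auto intro!: integral_Ici_nonneg H1_pairD[OF v] x H1_pair_weighted_bound[OF v])
  then show ?thesis by simp
qed

lemma H1_pair_bounded:
  assumes v: "H1_pair v g"
  obtains M where "0 < M" "\<And>x. 0 \<le> x \<Longrightarrow> \<bar>v x\<bar> \<le> M"
proof -
  define B where "B = integral {0..} (\<lambda>x. (v x)\<^sup>2) + integral {0..} (\<lambda>x. (g x)\<^sup>2)"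
  have "\<bar>v x\<bar> \<le> sqrt B + 1" if x: "0 \<le> x" for x
  proof -
    note ai = H1_pairD(2,3)[OF v]
    have "0 \<le> integral {0..x} (\<lambda>x. (v x)\<^sup>2)" "0 \<le> integral {0..x} (\<lambda>x. (g x)\<^sup>2)"
      using ai[THEN integral_Ici_split(2)[OF _ x]] by (auto intro!: Henstock_Kurzweil_Integration.integral_nonneg simp: absolutely_integrable_on_def)
    then have "(v x)\<^sup>2 \<le> B"
      using H1_pair_weighted_bound[OF v x, of 1] ai[THEN integral_Ici_split(3)[OF _ x]] by (simp add: B_def)
    then have "sqrt ((v x)\<^sup>2) \<le> sqrt B" by (rule real_sqrt_le_mono)
    then show ?thesis by simp
  qed
  moreover have "0 \<le> B"
    unfolding B_def by (intro add_nonneg_nonneg integral_Ici_nonneg H1_pairD[OF v]) auto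
  then have "0 < sqrt B + 1" by (simp add: add_nonneg_pos)
  ultimately show thesis using that by blast
qed

lemma abs_powr_le:
  fixes y M p :: real
  assumes "\<bar>y\<bar> \<le> M" "2 \<le> p"
  shows "\<bar>y\<bar> powr p \<le> M powr (p - 2) * y\<^sup>2"
proof (cases "y = 0")
  case False
  have "\<bar>y\<bar> powr p = \<bar>y\<bar> powr (p - 2) * \<bar>y\<bar> powr 2"
    by (simp only: powr_add[symmetric]) simp
  also have "\<bar>y\<bar> powr 2 = y\<^sup>2" using False by simp
  also have "\<bar>y\<bar> powr (p - 2) * y\<^sup>2 \<le> M powr (p - 2) * y\<^sup>2"
    using assms by (intro mult_right_mono powr_mono2) auto
  finally show ?thesis .
qed simp

lemma H1_pair_powr:
  assumes v: "H1_pair v g" and p: "2 \<le> p" and M: "\<And>x. 0 \<le> x \<Longrightarrow> \<bar>v x\<bar> \<le> M"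
  shows "(\<lambda>x. \<bar>v x\<bar> powr p) absolutely_integrable_on {0..}"
    and "0 \<le> x \<Longrightarrow> integral {x..} (\<lambda>x. \<bar>v x\<bar> powr p) \<le> M powr (p - 2) * integral {x..} (\<lambda>x. (v x)\<^sup>2)"
proof -
  note ai = H1_pairD(2)[OF v]
  show ap: "(\<lambda>x. \<bar>v x\<bar> powr p) absolutely_integrable_on {0..}"
  proof (rule measurable_bounded_by_integrable_imp_absolutely_integrable)
    have "continuous_on {0..} (\<lambda>x. \<bar>v x\<bar> powr p)"
      using p by (intro continuous_on_powr' continuous_intros H1_pair_continuous[OF v]) auto
    then show "(\<lambda>x. \<bar>v x\<bar> powr p) \<in> borel_measurable (lebesgue_on {0..})"
      by (rule continuous_imp_measurable_on_sets_lebesgue) auto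
    show "(\<lambda>x. M powr (p - 2) * (v x)\<^sup>2) integrable_on {0..}"
      using ai by (intro integrable_on_mult_right) (simp add: absolutely_integrable_on_def)
    show "norm (\<bar>v x\<bar> powr p) \<le> M powr (p - 2) * (v x)\<^sup>2" if "x \<in> {0..}" for x
      using abs_powr_le[OF M p] that by simp
  qed auto
  show "integral {x..} (\<lambda>x. \<bar>v x\<bar> powr p) \<le> M powr (p - 2) * integral {x..} (\<lambda>x. (v x)\<^sup>2)" if x: "0 \<le> x"
  proof -
    have "integral {x..} (\<lambda>x. \<bar>v x\<bar> powr p) \<le> integral {x..} (\<lambda>x. M powr (p - 2) * (v x)\<^sup>2)"
    proof (rule integral_le)
      show "(\<lambda>x. \<bar>v x\<bar> powr p) integrable_on {x..}" "(\<lambda>x. M powr (p - 2) * (v x)\<^sup>2) integrable_on {x..}"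
        using integral_Ici_split(1)[OF ap x] integral_Ici_split(1)[OF ai x]
        by (auto intro!: integrable_on_mult_right simp: absolutely_integrable_on_def)
      show "\<bar>v y\<bar> powr p \<le> M powr (p - 2) * (v y)\<^sup>2" if "y \<in> {x..}" for y
        using abs_powr_le[OF M p] that x by simp
    qed
    then show ?thesis by simp
  qed
qed

lemma energy_eq_pair_energy:
  assumes v: "H1_pair v g" and "2 \<le> p" and vu: "AE x in half_line. v x = u x"
    and rep: "cont_rep u 0 = v 0" and gu: "AE x in half_line. g x = weak_deriv u x"
  shows "energy p \<alpha> u = pair_energy p \<alpha> v g"
    and "(LINT x|half_line. \<bar>u x\<bar>\<^sup>2) = integral {0..} (\<lambda>x. (v x)\<^sup>2)"
proof -
  obtain M where M: "\<And>x. 0 \<le> x \<Longrightarrow> \<bar>v x\<bar> \<le> M" using H1_pair_bounded[OF v] by blast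
  have "AE x in half_line. (g x)\<^sup>2 = \<bar>weak_deriv u x\<bar>\<^sup>2" using gu by eventually_elim simp
  from LINT_half_line_AE[OF H1_pairD(3)[OF v] this]
  have "(LINT x|half_line. \<bar>weak_deriv u x\<bar>\<^sup>2) = integral {0..} (\<lambda>x. (g x)\<^sup>2)" .
  moreover have "AE x in half_line. \<bar>v x\<bar> powr p = \<bar>u x\<bar> powr p" using vu by eventually_elim simp
  from LINT_half_line_AE[OF H1_pair_powr(1)[OF v \<open>2 \<le> p\<close> M] this]
  have "(LINT x|half_line. \<bar>u x\<bar> powr p) = integral {0..} (\<lambda>x. \<bar>v x\<bar> powr p)" by simp
  ultimately show "energy p \<alpha> u = pair_energy p \<alpha> v g"
    by (simp add: energy_def pair_energy_def rep)
  have "AE x in half_line. (v x)\<^sup>2 = \<bar>u x\<bar>\<^sup>2" using vu by eventually_elim simp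
  from LINT_half_line_AE[OF H1_pairD(2)[OF v] this]
  show "(LINT x|half_line. \<bar>u x\<bar>\<^sup>2) = integral {0..} (\<lambda>x. (v x)\<^sup>2)" .
qed

section \<open>The calibration\<close>

text \<open>With \<open>s\<close> the value of the tangent, apply \<open>ln y \<le> y - 1\<close> at
  \<open>w / s\<close> and at \<open>1 / s\<close> with weights \<open>r\<close> and
  \<open>1 - r\<close>. The weighted mean of these two points is 1, so the right-hand sides cancel.
  Equality forces equality at \<open>1 / s\<close>, hence \<open>s = 1\<close>.\<close>

lemma powr_le_tangent:
  fixes r w :: real
  assumes r: "0 < r" "r < 1" and w: "0 \<le> w"
  shows "w powr r \<le> 1 + r * (w - 1)" and "w powr r = 1 + r * (w - 1) \<Longrightarrow> w = 1"
proof -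
  define s where "s = 1 + r * (w - 1)"
  have "s = (1 - r) + r * w" by (simp add: s_def algebra_simps)
  then have s: "s > 0" using r w by (simp add: add_pos_nonneg)
  have "w powr r \<le> s \<and> (w powr r = s \<longrightarrow> w = 1)"
  proof (cases "w = 0")
    case True
    then show ?thesis using s by auto
  next
    case False
    then have w: "w > 0" using w by simp
    have id: "r * (w / s - 1) + (1 - r) * (1 / s - 1) = 0"
      using s by (simp add: s_def field_simps)
    have lnid: "r * ln (w / s) + (1 - r) * ln (1 / s) = r * ln w - ln s"
      using w s by (simp add: ln_div algebra_simps)
    have l1: "r * ln (w / s) \<le> r * (w / s - 1)"
      using r w s by (intro mult_left_mono ln_le_minus_one) auto
    have l2: "(1 - r) * ln (1 / s) \<le> (1 - r) * (1 / s - 1)"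
      using r s by (intro mult_left_mono ln_le_minus_one) auto
    have le: "r * ln w \<le> ln s" using id lnid l1 l2 by linarith
    have wr: "w powr r = exp (r * ln w)" using w by (simp add: powr_def)
    have "exp (r * ln w) \<le> exp (ln s)" using le by simp
    then have "w powr r \<le> s" using wr s by simp
    moreover have "w = 1" if "w powr r = s"
    proof -
      have "r * ln w = ln s" using that wr by (metis ln_exp)
      then have "(1 - r) * ln (1 / s) = (1 - r) * (1 / s - 1)"
        using id lnid l1 l2 by linarith
      then have "ln (1 / s) = 1 / s - 1" using r by simp
      then have "1 / s = 1" by (rule ln_eq_minus_one[rotated]) (use s in simp)
      then have "r * (w - 1) = 0" by (simp add: s_def)
      then show ?thesis using r by simp
    qed
    ultimately show ?thesis by blast
  qed
  then show "w powr r \<le> 1 + r * (w - 1)" "w powr r = 1 + r * (w - 1) \<Longrightarrow> w = 1"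
    by (auto simp: s_def)
qed

text \<open>The defect of the concave function \<open>z \<mapsto> z powr ((p - 2) / 4)\<close> below its tangent, with \<open>z\<close> the
  fourth power of \<open>y\<close> and the tangent taken at the fourth power of \<open>a\<close>.\<close>

definition tangent_gap :: "real \<Rightarrow> real \<Rightarrow> real \<Rightarrow> real" where
  "tangent_gap p a y = (p - 2) / 4 * a powr (p - 6) * y ^ 4 + (6 - p) / 4 * a powr (p - 2) - \<bar>y\<bar> powr (p - 2)"

text \<open>Scaling by \<open>a\<close> reduces this to \<open>powr_le_tangent\<close> with
  \<open>r = (p - 2) / 4\<close> and \<open>w = (y / a) ^ 4\<close>. The sign of \<open>y\<close> is
  invisible, which is where positivity enters uniqueness.\<close>

lemma tangent_gap:
  assumes p: "2 < p" "p < 6" and a: "0 < a"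
  shows "0 \<le> tangent_gap p a y" and "tangent_gap p a y = 0 \<Longrightarrow> y ^ 4 = a ^ 4"
proof -
  define r w where "r = (p - 2) / 4" and "w = (y / a) ^ 4"
  have r: "0 < r" "r < 1" using p by (auto simp: r_def)
  have r4: "4 * r = p - 2" by (simp add: r_def)
  have w: "0 \<le> w" by (simp add: w_def)
  have "w powr r = \<bar>y / a\<bar> powr (4 * r)"
  proof (cases "y = 0")
    case False
    have "w = \<bar>y / a\<bar> ^ 4" using power_even_abs[of 4 "y / a"] by (simp add: w_def)
    also have "\<dots> = \<bar>y / a\<bar> powr 4" using False a by simp
    finally have "w = \<bar>y / a\<bar> powr 4" .
    then show ?thesis by (simp only: powr_powr)
  qed (use r in \<open>simp add: w_def\<close>)
  then have wr: "a powr (p - 2) * w powr r = \<bar>y\<bar> powr (p - 2)"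
    using a r4 by (simp add: powr_divide)
  have "a powr (p - 2) = a powr (p - 6) * a powr 4"
    by (simp only: powr_add[symmetric]) simp
  then have aw: "a powr (p - 2) * w = a powr (p - 6) * y ^ 4"
    using a by (simp add: w_def power_divide)
  have gap: "tangent_gap p a y = a powr (p - 2) * (1 + r * (w - 1) - w powr r)"
    using wr aw by (simp add: tangent_gap_def r_def algebra_simps)
      (simp add: diff_divide_distrib add_divide_distrib algebra_simps)
  show "0 \<le> tangent_gap p a y"
    unfolding gap using powr_le_tangent(1)[OF r w] by simp
  assume "tangent_gap p a y = 0"
  then have "w powr r = 1 + r * (w - 1)" using gap a by simp
  then have "w = 1" by (rule powr_le_tangent(2)[OF r w])
  then show "y ^ 4 = a ^ 4" using a by (simp add: w_def power_divide)
qed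

text \<open>The argument \<open>t\<close> of \<open>\<kappa>\<close>, \<open>U\<close>, \<open>\<tau>\<close> is the tail mass: at the point \<open>y\<close> with \<open>\<integral>\<^sub>y\<^sup>\<infinity> u\<^sup>2 = t\<close> the soliton
  \<open>u\<close> has the value \<open>U t\<close>, and \<open>\<kappa> t = - u' y / u y ^ 3\<close>, \<open>\<tau> t = \<integral>\<^sub>0\<^sup>y u powr p\<close>.\<close>

locale calibration =
  fixes p \<alpha> \<mu> T :: real and \<kappa> U \<tau> :: "real \<Rightarrow> real"
  assumes p: "2 < p" "p < 6" and \<alpha>: "\<alpha> < 0" and \<mu>: "0 < \<mu>"
    and U_pos: "\<And>t. 0 < t \<Longrightarrow> t \<le> \<mu> \<Longrightarrow> 0 < U t"
    and U_cont: "continuous_on {0<..\<mu>} U"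
    and \<kappa>_pos: "\<And>t. 0 < t \<Longrightarrow> t \<le> \<mu> \<Longrightarrow> 0 < \<kappa> t"
    and \<kappa>_deriv: "\<And>t. 0 < t \<Longrightarrow> t \<le> \<mu> \<Longrightarrow>
      (\<kappa> has_real_derivative - 2 * (\<kappa> t)\<^sup>2 - (p - 2) / p * U t powr (p - 6)) (at t)"
    and \<tau>_deriv: "\<And>t. 0 < t \<Longrightarrow> t \<le> \<mu> \<Longrightarrow> (\<tau> has_real_derivative - (U t powr (p - 2))) (at t)"
    and \<kappa>_end: "\<kappa> \<mu> * (U \<mu>)\<^sup>2 = - \<alpha>"
    and \<tau>_end: "\<tau> \<mu> = 0"
    and \<tau>_le: "\<And>t. 0 < t \<Longrightarrow> t \<le> \<mu> \<Longrightarrow> \<tau> t \<le> T"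
begin

text \<open>What is left when all estimates are equalities: the calibrating function contributes
  \<open>\<kappa> \<mu> * U \<mu> ^ 4 / 4\<close> at 0 and \<open>- (6 - p) / (4 * p) * T\<close> at
  infinity, and the former combines with the point term \<open>\<alpha> / 2 * U \<mu> ^ 2\<close>
  through \<open>\<kappa>_end\<close>.\<close>

definition level :: real where
  "level = \<alpha> * (U \<mu>)\<^sup>2 / 4 - (6 - p) / (4 * p) * T"

text \<open>The Riccati inequality \<open>\<kappa>' \<le> - 2 \<kappa>\<^sup>2\<close> bounds \<open>1 / \<kappa>\<close> from below by \<open>2 t\<close>; the constant matches
  the one in the decay estimate exactly.\<close>

lemma \<kappa>_le:
  assumes t: "0 < t" "t \<le> \<mu>"
  shows "2 * t * \<kappa> t \<le> 1"
proof -
  \<comment> \<open>The inequality is integrated from \<open>s > 0\<close>, as nothing is assumed at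
    0; positivity of \<open>inverse (\<kappa> s)\<close> takes the place of an initial
    value.\<close>
  have le: "2 * (t - s) \<le> inverse (\<kappa> t)" if s: "0 < s" "s < t" for s
  proof -
    have "inverse (\<kappa> s) - 2 * s \<le> inverse (\<kappa> t) - 2 * t"
    proof (rule DERIV_nonneg_imp_nondecreasing[of s t "\<lambda>x. inverse (\<kappa> x) - 2 * x"])
      show "s \<le> t" using s by simp
      fix x assume "s \<le> x" "x \<le> t"
      then have x: "0 < x" "x \<le> \<mu>" using s t by auto
      let ?k' = "- 2 * (\<kappa> x)\<^sup>2 - (p - 2) / p * U x powr (p - 6)"
      have "((\<lambda>x. inverse (\<kappa> x) - 2 * x) has_real_derivative - (inverse (\<kappa> x) * ?k' * inverse (\<kappa> x)) - 2) (at x)"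
        using \<kappa>_pos[OF x] by (auto intro!: derivative_eq_intros \<kappa>_deriv[OF x])
      moreover have "- (inverse (\<kappa> x) * ?k' * inverse (\<kappa> x)) - 2
          = (p - 2) / p * U x powr (p - 6) / (\<kappa> x)\<^sup>2"
        using \<kappa>_pos[OF x] by (simp add: field_simps power2_eq_square)
      moreover have "0 \<le> (p - 2) / p * U x powr (p - 6) / (\<kappa> x)\<^sup>2" using p by simp
      ultimately show "\<exists>y. ((\<lambda>x. inverse (\<kappa> x) - 2 * x) has_real_derivative y) (at x) \<and> 0 \<le> y"
        by metis
    qed
    moreover have "0 < inverse (\<kappa> s)" using \<kappa>_pos[of s] s t by simp
    ultimately show ?thesis by argo
  qed
  have "2 * t \<le> inverse (\<kappa> t)"
  proof (rule field_le_epsilon)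
    fix e :: real assume e: "0 < e"
    have "0 < min (e / 2) (t / 2)" "min (e / 2) (t / 2) < t" using e t by auto
    from le[OF this] show "2 * t \<le> inverse (\<kappa> t) + e" by (simp add: min_def split: if_splits)
  qed
  then show ?thesis using \<kappa>_pos[OF t] by (simp add: field_simps)
qed

lemma continuous_on_\<kappa>: "continuous_on {0<..\<mu>} \<kappa>"
  by (rule continuous_at_imp_continuous_on) (use DERIV_isCont[OF \<kappa>_deriv] in auto)

end

text \<open>With \<open>k\<close>, \<open>P\<close>, \<open>Q\<close>, \<open>R\<close> standing for \<open>\<kappa>\<close>, \<open>U powr (p - 6)\<close>, \<open>U powr (p - 2)\<close>, \<open>\<bar>v\<bar> powr (p - 2)\<close> and \<open>g\<close>
  for \<open>v'\<close>, the middle summand is the derivative of the calibrating function along \<open>v\<close>.\<close>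

lemma calibration_identity:
  fixes p v g k P Q R :: real
  assumes "p \<noteq> 0"
  shows "1 / 2 * g\<^sup>2 - (v\<^sup>2 * R) / p =
    v\<^sup>2 / p * ((p - 2) / 4 * P * v ^ 4 + (6 - p) / 4 * Q - R)
    + (- 1 / 4 * ((- 2 * k\<^sup>2 - (p - 2) / p * P) * - v\<^sup>2 * ((v * v) * (v * v))
        + ((g * v + g * v) * (v * v) + (g * v + g * v) * (v * v)) * k)
      + - ((6 - p) / (4 * p)) * (- Q * - v\<^sup>2))
    + 1 / 2 * (g + k * v ^ 3)\<^sup>2"
  using assms by (simp add: field_simps power2_eq_square power3_eq_cube power4_eq_xxxx)

section \<open>Energy lower bound and its equality case\<close>

lemma primitive_on_lincomb:
  assumes "primitive_on a b F f" "primitive_on a b G g"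
  shows "primitive_on a b (\<lambda>x. c * F x + d * G x) (\<lambda>x. c * f x + d * g x)"
proof (rule primitive_onI)
  note F = primitive_onD[OF assms(1)] and G = primitive_onD[OF assms(2)]
  show "(\<lambda>x. c * f x + d * g x) absolutely_integrable_on {a..b}"
    using F(1) G(1) by (intro set_integral_add set_integrable_mult_right) auto
  fix x assume x: "x \<in> {a..b}"
  have "f integrable_on {a..x}" "g integrable_on {a..x}"
    using x by (auto intro: integrable_subinterval_real F(2) G(2))
  then show "integral {a..x} (\<lambda>x. c * f x + d * g x) = c * F x + d * G x - (c * F a + d * G a)"
    by (simp add: Henstock_Kurzweil_Integration.integral_add integrable_on_mult_right F(3)[OF x] G(3)[OF x] right_diff_distrib)
qed

text \<open>The last fact allows a cutoff to be chosen by its tail mass instead of its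
  position.\<close>

lemma tail_mass:
  assumes v: "H1_pair v g"
  defines "m \<equiv> \<lambda>x. integral {x..} (\<lambda>x. (v x)\<^sup>2)"
  shows "\<And>x y. 0 \<le> x \<Longrightarrow> x \<le> y \<Longrightarrow> m y \<le> m x"
    and "\<And>x. 0 \<le> x \<Longrightarrow> 0 \<le> m x"
    and "\<And>X x. x \<in> {0..X} \<Longrightarrow> (m has_real_derivative - (v x)\<^sup>2) (at x within {0..X})"
    and "\<And>e. 0 < e \<Longrightarrow> e < m 0 \<Longrightarrow> \<exists>x\<ge>0. m x = e"
proof -
  note ai = H1_pairD(2)[OF v]
  have m: "m x = m 0 - integral {0..x} (\<lambda>x. (v x)\<^sup>2)" if "0 \<le> x" for x
    using integral_Ici_split(3)[OF ai that] by (simp add: m_def)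
  show nonneg: "0 \<le> m x" if "0 \<le> x" for x
    unfolding m_def by (rule integral_Ici_nonneg[OF ai that]) simp
  show D: "(m has_real_derivative - (v x)\<^sup>2) (at x within {0..X})" if x: "x \<in> {0..X}" for x X
  proof -
    have cont: "continuous_on {0..X} (\<lambda>x. (v x)\<^sup>2)"
      by (intro continuous_on_power continuous_on_subset[OF H1_pair_continuous[OF v]]) auto
    have "((\<lambda>x. m 0 - integral {0..x} (\<lambda>x. (v x)\<^sup>2)) has_real_derivative 0 - (v x)\<^sup>2) (at x within {0..X})"
      by (intro DERIV_diff DERIV_const integral_has_real_derivative cont x)
    then have "(m has_real_derivative 0 - (v x)\<^sup>2) (at x within {0..X})"
    proof (rule has_field_derivative_transform_within[OF _ zero_less_one x])
      fix y assume "y \<in> {0..X}"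
      then have "0 \<le> y" by simp
      from m[OF this] show "m 0 - integral {0..y} (\<lambda>x. (v x)\<^sup>2) = m y" by simp
    qed
    then show ?thesis by simp
  qed
  show mono: "m y \<le> m x" if "0 \<le> x" "x \<le> y" for x y
  proof -
    have "integral {0..x} (\<lambda>x. (v x)\<^sup>2) \<le> integral {0..y} (\<lambda>x. (v x)\<^sup>2)"
      using ai[THEN integral_Ici_split(2)] that by (intro integral_subset_le) (auto simp: absolutely_integrable_on_def)
    then show ?thesis using m[of x] m[of y] that by simp
  qed
  show "\<exists>x\<ge>0. m x = e" if e: "0 < e" "e < m 0" for e
  proof -
    have cont: "continuous_on {0..X} m" for X
      by (rule DERIV_continuous_on[OF D])
    obtain X where X: "0 \<le> X" "m X < e"
    proof -
      have "((\<lambda>X. integral {0..X} (\<lambda>x. (v x)\<^sup>2)) \<longlongrightarrow> m 0) at_top"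
        unfolding m_def by (rule integral_Icc_tendsto_Ici[OF ai])
      then have "\<forall>\<^sub>F X in at_top. m 0 - e < integral {0..X} (\<lambda>x. (v x)\<^sup>2)"
        by (rule order_tendstoD) (use e in simp)
      then have "\<forall>\<^sub>F X in at_top. 0 \<le> X \<and> m X < e"
        using eventually_ge_at_top[of 0]
      proof eventually_elim
        case (elim X)
        then show ?case using m[of X] by simp
      qed
      then show thesis using that eventually_happens'[OF trivial_limit_at_top_linorder] by blast
    qed
    from IVT2'[of m X e 0] X e cont show ?thesis by fastforce
  qed
qed


text \<open>The identity is integrated only up to \<open>X\<close>, where the tail mass is still
  positive and \<open>\<kappa>\<close>, \<open>U\<close>, \<open>\<tau>\<close> make sense along
  \<open>v\<close>. Beyond \<open>X\<close> the kinetic energy absorbs the boundary term, and the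
  nonlinear term costs at most a multiple of the tail mass. The integral of \<open>gap\<close> is
  kept in the bound because it decides the equality case.\<close>

lemma (in calibration) energy_lower_bound:
  assumes v: "H1_pair v g" and mass: "integral {0..} (\<lambda>x. (v x)\<^sup>2) = \<mu>" and X: "0 \<le> X"
  defines "m \<equiv> \<lambda>x. integral {x..} (\<lambda>x. (v x)\<^sup>2)"
  defines "gap \<equiv> \<lambda>x. (v x)\<^sup>2 / p * tangent_gap p (U (m x)) (v x)"
  assumes mX: "0 < m X" and M: "\<And>x. 0 \<le> x \<Longrightarrow> \<bar>v x\<bar> \<le> M"
  shows "continuous_on {0..X} gap"
    and "level + integral {0..X} gap - 1 / p * (M powr (p - 2) * m X) \<le> pair_energy p \<alpha> v g"
proof -
  note ai = H1_pairD[OF v]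
  have m0: "m 0 = \<mu>" using mass by (simp add: m_def)
  have m_range: "0 < m x" "m x \<le> \<mu>" if "x \<in> {0..X}" for x
    using tail_mass(1)[OF v, of x X] tail_mass(1)[OF v, of 0 x] mX m0 that by (auto simp: m_def)
  have m_deriv: "(m has_real_derivative - (v x)\<^sup>2) (at x within {0..X})" if "x \<in> {0..X}" for x
    using tail_mass(3)[OF v that] by (simp add: m_def)
  have m_cont: "continuous_on {0..X} m"
    by (rule DERIV_continuous_on[OF m_deriv])
  have m_img: "m ` {0..X} \<subseteq> {0<..\<mu>}" using m_range by auto
  have v_cont: "continuous_on {0..X} v"
    by (rule continuous_on_subset[OF H1_pair_continuous[OF v]]) auto
  have U_m: "continuous_on {0..X} (\<lambda>x. U (m x))"
    by (rule continuous_on_compose2[OF U_cont m_cont m_img])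
  have \<kappa>_m: "continuous_on {0..X} (\<lambda>x. \<kappa> (m x))"
    by (rule continuous_on_compose2[OF continuous_on_\<kappa> m_cont m_img])
  have U_m_powr: "continuous_on {0..X} (\<lambda>x. U (m x) powr q)" for q
  proof (intro continuous_on_powr U_m continuous_on_const ballI)
    show "U (m x) \<noteq> 0" if "x \<in> {0..X}" for x
      using U_pos[OF m_range[OF that]] by simp
  qed
  have v_powr: "continuous_on {0..X} (\<lambda>x. \<bar>v x\<bar> powr q)" if "0 < q" for q
    by (rule continuous_on_powr'[OF continuous_on_rabs[OF v_cont] continuous_on_const]) (simp add: that)
  show gap_cont: "continuous_on {0..X} gap"
    unfolding gap_def tangent_gap_def
    by (rule continuous_on_mult continuous_on_add continuous_on_diff continuous_on_divide continuous_on_power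
        continuous_on_const v_cont U_m_powr v_powr | use p in simp)+
  define A where "A x = - 2 * (\<kappa> (m x))\<^sup>2 - (p - 2) / p * U (m x) powr (p - 6)" for x
  define Q where "Q x = U (m x) powr (p - 2)" for x
  have P\<kappa>: "primitive_on 0 X (\<lambda>x. \<kappa> (m x)) (\<lambda>x. A x * - (v x)\<^sup>2)"
  proof (rule primitive_on_C1)
    show "((\<lambda>x. \<kappa> (m x)) has_real_derivative A x * - (v x)\<^sup>2) (at x within {0..X})" if "x \<in> {0..X}" for x
      unfolding A_def by (rule DERIV_chain2[OF \<kappa>_deriv[OF m_range[OF that]] m_deriv[OF that]])
    show "continuous_on {0..X} (\<lambda>x. A x * - (v x)\<^sup>2)"
      unfolding A_def by (intro continuous_intros \<kappa>_m U_m_powr v_cont)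
  qed
  have P\<tau>: "primitive_on 0 X (\<lambda>x. \<tau> (m x)) (\<lambda>x. - Q x * - (v x)\<^sup>2)"
  proof (rule primitive_on_C1)
    show "((\<lambda>x. \<tau> (m x)) has_real_derivative - Q x * - (v x)\<^sup>2) (at x within {0..X})" if "x \<in> {0..X}" for x
      unfolding Q_def by (rule DERIV_chain2[OF \<tau>_deriv[OF m_range[OF that]] m_deriv[OF that]])
    show "continuous_on {0..X} (\<lambda>x. - Q x * - (v x)\<^sup>2)"
      unfolding Q_def by (intro continuous_intros U_m_powr v_cont)
  qed
  note Pv2 = primitive_on_mult[OF ai(1)[of X] ai(1)[of X]]
  note D = primitive_on_lincomb[OF primitive_on_mult[OF P\<kappa> primitive_on_mult[OF Pv2 Pv2]] P\<tau>,
      of "- 1 / 4" "- ((6 - p) / (4 * p))"]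
  define D' where "D' x = - 1 / 4 * (A x * - (v x)\<^sup>2 * ((v x * v x) * (v x * v x))
        + ((g x * v x + g x * v x) * (v x * v x) + (g x * v x + g x * v x) * (v x * v x)) * \<kappa> (m x))
      + - ((6 - p) / (4 * p)) * (- Q x * - (v x)\<^sup>2)" for x
  have D'_int: "D' integrable_on {0..X}"
    using primitive_onD(2)[OF D] unfolding D'_def .
  have "integral {0..X} D' = - 1 / 4 * (\<kappa> (m X) * ((v X * v X) * (v X * v X))) + - ((6 - p) / (4 * p)) * \<tau> (m X)
      - (- 1 / 4 * (\<kappa> (m 0) * ((v 0 * v 0) * (v 0 * v 0))) + - ((6 - p) / (4 * p)) * \<tau> (m 0))"
    using primitive_onD(3)[OF D, of X] X unfolding D'_def by simp
  then have intD': "integral {0..X} D' =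
      - (\<kappa> (m X) * v X ^ 4) / 4 - (6 - p) / (4 * p) * \<tau> (m X) + \<kappa> \<mu> * v 0 ^ 4 / 4"
    by (simp add: m0 \<tau>_end power4_eq_xxxx)
  have sq_int: "(\<lambda>x. (g x)\<^sup>2) integrable_on {0..X}"
    using integral_Ici_split(2)[OF ai(3) X] by (simp add: absolutely_integrable_on_def)
  have pw_ai: "(\<lambda>x. \<bar>v x\<bar> powr p) absolutely_integrable_on {0..}"
    using H1_pair_powr(1)[OF v _ M] p by simp
  then have pw_int: "(\<lambda>x. \<bar>v x\<bar> powr p) integrable_on {0..X}"
    using integral_Ici_split(2)[OF _ X] by (simp add: absolutely_integrable_on_def)
  have gap_int: "gap integrable_on {0..X}" by (rule integrable_continuous_interval[OF gap_cont])
  \<comment> \<open>Only the square \<open>(g + \<kappa> * v ^ 3) ^ 2 / 2\<close> of the calibration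
    identity is dropped here.\<close>
  have "integral {0..X} (\<lambda>x. gap x + D' x) \<le> integral {0..X} (\<lambda>x. 1 / 2 * (g x)\<^sup>2 - \<bar>v x\<bar> powr p / p)"
  proof (rule integral_le)
    show "(\<lambda>x. gap x + D' x) integrable_on {0..X}" by (rule integrable_add[OF gap_int D'_int])
    show "(\<lambda>x. 1 / 2 * (g x)\<^sup>2 - \<bar>v x\<bar> powr p / p) integrable_on {0..X}"
      by (intro integrable_diff integrable_on_mult_right integrable_on_divide sq_int pw_int)
    fix x
    have pw: "\<bar>v x\<bar> powr p = (v x)\<^sup>2 * \<bar>v x\<bar> powr (p - 2)"
    proof (cases "v x = 0")
      case False
      have "\<bar>v x\<bar> powr p = \<bar>v x\<bar> powr 2 * \<bar>v x\<bar> powr (p - 2)"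
        by (simp only: powr_add[symmetric]) simp
      then show ?thesis using False by simp
    qed simp
    have sq: "0 \<le> 1 / 2 * (g x + \<kappa> (m x) * v x ^ 3)\<^sup>2" by simp
    have "p \<noteq> 0" using p by simp
    from calibration_identity[OF this, of "g x" "v x" "\<bar>v x\<bar> powr (p - 2)" "U (m x) powr (p - 6)" "Q x" "\<kappa> (m x)"] sq
    show "gap x + D' x \<le> 1 / 2 * (g x)\<^sup>2 - \<bar>v x\<bar> powr p / p"
      unfolding pw gap_def D'_def A_def tangent_gap_def Q_def by linarith
  qed
  then have lower: "integral {0..X} gap + integral {0..X} D'
      \<le> 1 / 2 * integral {0..X} (\<lambda>x. (g x)\<^sup>2) - integral {0..X} (\<lambda>x. \<bar>v x\<bar> powr p) / p"
    using gap_int D'_int sq_int pw_int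
    by (simp add: Henstock_Kurzweil_Integration.integral_add Henstock_Kurzweil_Integration.integral_diff
        integrable_on_divide)
  \<comment> \<open>The constants fit without loss: the factor 4 of the decay estimate cancels the
    1/4, and \<open>2 * m X * \<kappa> (m X) \<le> 1\<close> leaves exactly half of the remaining
    kinetic integral.\<close>
  have boundary: "\<kappa> (m X) * v X ^ 4 / 4 \<le> 1 / 2 * integral {X..} (\<lambda>x. (g x)\<^sup>2)"
  proof -
    have mr: "0 < m X" "m X \<le> \<mu>" using m_range[of X] X by auto
    have "\<kappa> (m X) * v X ^ 4 \<le> \<kappa> (m X) * (4 * m X * integral {X..} (\<lambda>x. (g x)\<^sup>2))"
      using H1_pair_decay[OF v X] \<kappa>_pos[OF mr] by (intro mult_left_mono) (auto simp: m_def)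
    also have "\<dots> = 2 * m X * \<kappa> (m X) * (2 * integral {X..} (\<lambda>x. (g x)\<^sup>2))" by simp
    also have "\<dots> \<le> 1 * (2 * integral {X..} (\<lambda>x. (g x)\<^sup>2))"
      using \<kappa>_le[OF mr] integral_Ici_nonneg[OF ai(3) X] by (intro mult_right_mono) auto
    finally show ?thesis by simp
  qed
  have "(6 - p) / (4 * p) * \<tau> (m X) \<le> (6 - p) / (4 * p) * T"
    using \<tau>_le[OF m_range[of X]] X p by (intro mult_left_mono) auto
  \<comment> \<open>The tangent inequality for the convex boundary term
    \<open>\<alpha> / 2 * sqrt z\<close> at \<open>z = U \<mu> ^ 4\<close>, obtained by completing
    the square in \<open>(v 0) ^ 2\<close>.\<close>
  moreover have "level + (6 - p) / (4 * p) * T \<le> \<kappa> \<mu> * v 0 ^ 4 / 4 + \<alpha> / 2 * (v 0)\<^sup>2"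
  proof -
    have U: "0 < U \<mu>" using U_pos \<mu> by simp
    have \<kappa>: "\<kappa> \<mu> = - \<alpha> / (U \<mu>)\<^sup>2" using \<kappa>_end U by (simp add: field_simps)
    have "\<kappa> \<mu> * v 0 ^ 4 / 4 + \<alpha> / 2 * (v 0)\<^sup>2 - \<alpha> * (U \<mu>)\<^sup>2 / 4
        = (- \<alpha>) / 4 * ((v 0)\<^sup>2 / U \<mu> - U \<mu>)\<^sup>2"
      using U by (simp add: \<kappa> field_simps power2_eq_square power4_eq_xxxx)
    moreover have "0 \<le> (- \<alpha>) / 4 * ((v 0)\<^sup>2 / U \<mu> - U \<mu>)\<^sup>2"
      using \<alpha> by (intro mult_nonneg_nonneg zero_le_power2) simp
    ultimately show ?thesis unfolding level_def by linarith
  qed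
  moreover have "integral {X..} (\<lambda>x. \<bar>v x\<bar> powr p) / p \<le> 1 / p * (M powr (p - 2) * m X)"
    using H1_pair_powr(2)[OF v _ M X, of p] p by (simp add: m_def divide_right_mono)
  moreover have "1 / 2 * integral {0..} (\<lambda>x. (g x)\<^sup>2)
      = 1 / 2 * integral {0..X} (\<lambda>x. (g x)\<^sup>2) + 1 / 2 * integral {X..} (\<lambda>x. (g x)\<^sup>2)"
    using integral_Ici_split(3)[OF ai(3) X] by simp
  moreover have "1 / p * integral {0..} (\<lambda>x. \<bar>v x\<bar> powr p)
      = integral {0..X} (\<lambda>x. \<bar>v x\<bar> powr p) / p + integral {X..} (\<lambda>x. \<bar>v x\<bar> powr p) / p"
    using integral_Ici_split(3)[OF pw_ai X] by (simp add: add_divide_distrib[symmetric])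
  ultimately show "level + integral {0..X} gap - 1 / p * (M powr (p - 2) * m X) \<le> pair_energy p \<alpha> v g"
    using lower boundary unfolding pair_energy_def intD' by linarith
qed

text \<open>The error at the cutoff is linear in the tail mass there, and every small tail mass
  \<open>e\<close> is attained, so \<open>e\<close> can tend to 0.\<close>

lemma (in calibration) energy_ge_level:
  assumes v: "H1_pair v g" and mass: "integral {0..} (\<lambda>x. (v x)\<^sup>2) = \<mu>"
  shows "level \<le> pair_energy p \<alpha> v g"
proof -
  define m where "m x = integral {x..} (\<lambda>x. (v x)\<^sup>2)" for x
  obtain M where M: "0 < M" "\<And>x. 0 \<le> x \<Longrightarrow> \<bar>v x\<bar> \<le> M" using H1_pair_bounded[OF v] by blast
  define C where "C = 1 / p * M powr (p - 2)"
  have bound: "level - C * e \<le> pair_energy p \<alpha> v g" if e: "0 < e" "e < \<mu>" for e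
  proof -
    obtain X where X: "0 \<le> X" "m X = e"
      using tail_mass(4)[OF v e(1)] e(2) mass by (auto simp: m_def)
    let ?gap = "\<lambda>x. (v x)\<^sup>2 / p * tangent_gap p (U (m x)) (v x)"
    have mX: "0 < integral {X..} (\<lambda>x. (v x)\<^sup>2)" using X e by (simp add: m_def)
    note lb = energy_lower_bound[OF v mass X(1) mX M(2), folded m_def]
    have "0 \<le> integral {0..X} ?gap"
    proof (rule Henstock_Kurzweil_Integration.integral_nonneg)
      show "?gap integrable_on {0..X}" by (rule integrable_continuous_interval[OF lb(1)])
      fix x assume x: "x \<in> {0..X}"
      have "0 < m x" "m x \<le> \<mu>"
        using tail_mass(1)[OF v, of x X] tail_mass(1)[OF v, of 0 x] mX mass x by (auto simp: m_def)
      then show "0 \<le> ?gap x" using tangent_gap(1)[OF p U_pos] p by simp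
    qed
    then show ?thesis using lb(2) X by (simp add: C_def)
  qed
  have "((\<lambda>e. level - C * e) \<longlongrightarrow> level - C * 0) (at_right 0)" by (intro tendsto_intros)
  moreover have "\<forall>\<^sub>F e in at_right 0. level - C * e \<le> pair_energy p \<alpha> v g"
    using eventually_at_right_less[of 0] eventually_at_right_real[OF \<mu>]
    by eventually_elim (use bound in auto)
  ultimately show ?thesis using tendsto_upperbound[of "\<lambda>e. level - C * e" "level - C * 0" "at_right 0"] by simp
qed

text \<open>At energy \<open>level\<close> the integral of the nonnegative \<open>gap\<close> is at
  most \<open>C\<close> times an arbitrarily small tail mass, so the continuous function
  \<open>gap\<close> vanishes. Strict convexity of the nonlinear term then identifies
  \<open>v\<close> with the soliton's value at equal tail mass.\<close>

lemma (in calibration) energy_eq_level: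
  assumes v: "H1_pair v g" and mass: "integral {0..} (\<lambda>x. (v x)\<^sup>2) = \<mu>"
    and pos: "\<And>x. 0 < x \<Longrightarrow> 0 < v x" and eq: "pair_energy p \<alpha> v g = level" and x: "0 < x"
  shows "0 < integral {x..} (\<lambda>x. (v x)\<^sup>2)" "v x = U (integral {x..} (\<lambda>x. (v x)\<^sup>2))"
proof -
  define m where "m x = integral {x..} (\<lambda>x. (v x)\<^sup>2)" for x
  define gap where "gap x = (v x)\<^sup>2 / p * tangent_gap p (U (m x)) (v x)" for x
  have gap_eq: "gap = (\<lambda>x. (v x)\<^sup>2 / p * tangent_gap p (U (m x)) (v x))"
    by (simp add: gap_def fun_eq_iff)
  obtain M where M: "0 < M" "\<And>x. 0 \<le> x \<Longrightarrow> \<bar>v x\<bar> \<le> M" using H1_pair_bounded[OF v] by blast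
  define C where "C = 1 / p * M powr (p - 2)"
  have m_pos: "0 < m x" if "0 \<le> x" for x
  proof -
    \<comment> \<open>Shifted by 1 because positivity of \<open>v\<close> is known only to the right
      of 0, while \<open>x\<close> may be 0.\<close>
    have cont: "continuous_on {x + 1..x + 2} (\<lambda>x. (v x)\<^sup>2)"
      using that by (intro continuous_on_power continuous_on_subset[OF H1_pair_continuous[OF v]]) auto
    have "0 \<le> integral {x + 1..x + 2} (\<lambda>x. (v x)\<^sup>2)"
      by (rule Henstock_Kurzweil_Integration.integral_nonneg[OF integrable_continuous_interval[OF cont]]) simp
    moreover have "(v (x + 1))\<^sup>2 \<noteq> 0" using pos[of "x + 1"] that by simp
    then have "integral {x + 1..x + 2} (\<lambda>x. (v x)\<^sup>2) \<noteq> 0"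
      by (subst integral_eq_0_iff[OF cont]) auto
    moreover have "integral {x + 1..x + 2} (\<lambda>x. (v x)\<^sup>2) \<le> m (x + 1)"
      unfolding m_def using that by (intro integral_Icc_le_Ici H1_pairD[OF v]) auto
    moreover have "m (x + 1) \<le> m x" using tail_mass(1)[OF v, of x "x + 1"] that by (simp add: m_def)
    ultimately show ?thesis by linarith
  qed
  then show "0 < integral {x..} (\<lambda>x. (v x)\<^sup>2)" using x by (simp add: m_def)
  have m_le: "m x \<le> \<mu>" if "0 \<le> x" for x
    using tail_mass(1)[OF v, of 0 x] mass that by (simp add: m_def)
  have gap_nonneg: "0 \<le> gap x" if "0 \<le> x" for x
    using tangent_gap(1)[OF p U_pos[OF m_pos[OF that] m_le[OF that]]] p by (simp add: gap_def)
  have lb: "continuous_on {0..X} gap" "integral {0..X} gap \<le> C * m X" if X: "0 \<le> X" for X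
  proof -
    have "0 < integral {X..} (\<lambda>x. (v x)\<^sup>2)" using m_pos[OF X] by (simp add: m_def)
    note bound = energy_lower_bound[OF v mass X this M(2), folded m_def, folded gap_eq]
    show "continuous_on {0..X} gap" by (rule bound(1))
    show "integral {0..X} gap \<le> C * m X" using bound(2) eq by (simp add: C_def)
  qed
  have "integral {0..x} gap \<le> C * e" if e: "0 < e" "e < \<mu>" for e
  proof -
    obtain X where X: "0 \<le> X" "m X = e"
      using tail_mass(4)[OF v e(1)] e(2) mass by (auto simp: m_def)
    \<comment> \<open>The point with tail mass \<open>e\<close> may lie to the left of
      \<open>x\<close>; moving right enlarges the integral of \<open>gap\<close> and lowers the tail
      mass.\<close>
    let ?Y = "max x X"
    have "integral {0..x} gap \<le> integral {0..?Y} gap"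
      using lb(1) x gap_nonneg by (intro integral_subset_le integrable_continuous_interval) auto
    also have "\<dots> \<le> C * m ?Y" using lb(2) x by simp
    also have "\<dots> \<le> C * m X"
      using tail_mass(1)[OF v, of X ?Y] X p M(1) by (intro mult_left_mono) (auto simp: m_def C_def)
    finally show ?thesis using X by simp
  qed
  then have "\<forall>\<^sub>F e in at_right 0. integral {0..x} gap \<le> C * e"
    using eventually_at_right_less[of 0] eventually_at_right_real[OF \<mu>]
    by (auto elim: eventually_elim2)
  moreover have "((\<lambda>e. C * e) \<longlongrightarrow> C * 0) (at_right 0)" by (intro tendsto_intros)
  ultimately have "integral {0..x} gap \<le> 0"
    using tendsto_lowerbound[of "\<lambda>e. C * e" "C * 0" "at_right 0"] by simp
  moreover have "0 \<le> integral {0..x} gap"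
    using gap_nonneg lb(1) x by (intro Henstock_Kurzweil_Integration.integral_nonneg integrable_continuous_interval) auto
  ultimately have "integral {0..x} gap = 0" by simp
  then have "\<forall>y\<in>{0..x}. gap y = 0"
    using integral_eq_0_iff[OF lb(1)[of x] x] gap_nonneg x by auto
  then have "gap x = 0" using x by simp
  then have "tangent_gap p (U (m x)) (v x) = 0" using pos[OF x] p by (simp add: gap_def)
  then have "v x ^ 4 = U (m x) ^ 4"
    using tangent_gap(2)[OF p U_pos] m_pos m_le x by simp
  then show "v x = U (integral {x..} (\<lambda>x. (v x)\<^sup>2))"
    using pos[OF x] U_pos[of "m x"] m_pos m_le x by (simp add: m_def power_eq_iff_eq_base)
qed

section \<open>The soliton\<close>

text \<open>This is \<open>cosh y powr (- \<beta>)\<close>; in exponential form, taking powers just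
  rescales \<open>\<beta>\<close>.\<close>

definition sech_powr :: "real \<Rightarrow> real \<Rightarrow> real" where
  "sech_powr \<beta> y = exp (- \<beta> * ln (cosh y))"

lemma sech_powr_pos: "0 < sech_powr \<beta> y"
  by (simp add: sech_powr_def)

lemma has_real_derivative_ln_cosh: "((\<lambda>y. ln (cosh y)) has_real_derivative tanh y) (at (y::real))"
  by (auto intro!: derivative_eq_intros simp: tanh_def cosh_real_pos)

lemma has_real_derivative_sech_powr:
  "(sech_powr \<beta> has_real_derivative - \<beta> * tanh y * sech_powr \<beta> y) (at y)"
proof -
  have "((\<lambda>y. exp (- \<beta> * ln (cosh y))) has_real_derivative exp (- \<beta> * ln (cosh y)) * (- \<beta> * tanh y)) (at y)"
    by (intro DERIV_fun_exp DERIV_cmult has_real_derivative_ln_cosh)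
  then show ?thesis unfolding sech_powr_def[abs_def] by (simp add: mult_ac)
qed

lemma sech_powr_le_exp:
  assumes "0 \<le> \<beta>"
  shows "sech_powr \<beta> y \<le> exp (\<beta> * ln 2) * exp (- \<beta> * y)"
proof -
  have "exp y / 2 \<le> cosh y" by (simp add: cosh_def)
  then have "ln (exp y / 2) \<le> ln (cosh y)" by (subst ln_le_cancel_iff) (auto simp: cosh_real_pos)
  then have "y - ln 2 \<le> ln (cosh y)" by (simp add: ln_div)
  then have "\<beta> * (y - ln 2) \<le> \<beta> * ln (cosh y)" using assms by (rule mult_left_mono)
  then show ?thesis by (simp add: sech_powr_def exp_add[symmetric] algebra_simps)
qed

lemma sech_powr_powr: "sech_powr \<beta> y powr q = sech_powr (\<beta> * q) y"
  by (simp add: sech_powr_def exp_powr_real[symmetric] powr_def mult_ac)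

lemma sech_powr_2: "sech_powr 2 y = 1 - (tanh y)\<^sup>2"
proof -
  have "sech_powr 2 y = inverse ((cosh y)\<^sup>2)"
    by (simp add: sech_powr_def exp_minus exp_of_nat_mult[of 2, simplified] cosh_real_pos)
  also have "\<dots> = ((cosh y)\<^sup>2 - (sinh y)\<^sup>2) / (cosh y)\<^sup>2"
    by (simp add: hyperbolic_pythagoras divide_inverse)
  also have "\<dots> = 1 - (tanh y)\<^sup>2"
    using cosh_real_pos[of y] by (simp add: tanh_def power_divide diff_divide_distrib)
  finally show ?thesis .
qed

lemma tail_sech_powr:
  assumes \<beta>: "0 < \<beta>"
  shows "\<exists>N. (\<forall>y>0. (N has_real_derivative - sech_powr \<beta> y) (at y)) \<and> (\<forall>y. 0 \<le> y \<longrightarrow> 0 < N y) \<and>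
    (\<forall>x y. 0 \<le> x \<longrightarrow> x \<le> y \<longrightarrow> N y \<le> N x) \<and> (N \<longlongrightarrow> 0) at_top"
proof -
  let ?f = "sech_powr \<beta>"
  have contf: "continuous_on S ?f" for S
    by (meson DERIV_isCont continuous_at_imp_continuous_on has_real_derivative_sech_powr)
  have ai: "?f absolutely_integrable_on {0..}"
  proof (rule measurable_bounded_by_integrable_imp_absolutely_integrable)
    show "?f \<in> borel_measurable (lebesgue_on {0..})"
      by (rule continuous_imp_measurable_on_sets_lebesgue[OF contf]) auto
    show "(\<lambda>y. exp (\<beta> * ln 2) * exp (- \<beta> * y)) integrable_on {0..}"
      by (intro integrable_on_mult_right integrable_on_exp_minus_to_infinity \<beta>)
    show "norm (?f y) \<le> exp (\<beta> * ln 2) * exp (- \<beta> * y)" for y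
      using sech_powr_le_exp[of \<beta> y] sech_powr_pos[of \<beta> y] \<beta> by simp
  qed auto
  define N where "N y = integral {0..} ?f - integral {0..y} ?f" for y
  have intf: "?f integrable_on {a..b}" for a b by (rule integrable_continuous_interval[OF contf])
  have D: "(N has_real_derivative - ?f y) (at y)" if "0 < y" for y
  proof -
    have "((\<lambda>y. integral {0..} ?f - integral {0..y} ?f) has_real_derivative 0 - ?f y) (at y within {0..y + 1})"
      using that by (intro DERIV_diff DERIV_const integral_has_real_derivative contf) auto
    moreover have "at y within {0..y + 1} = at y"
      using that by (intro at_within_interior) (auto simp: interior_atLeastAtMost_real)
    ultimately show ?thesis unfolding N_def[abs_def] by simp
  qed
  have step: "N y = N x - integral {x..y} ?f" if "0 \<le> x" "x \<le> y" for x y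
    using Henstock_Kurzweil_Integration.integral_combine[OF that intf] by (simp add: N_def)
  have mono: "N y \<le> N x" if "0 \<le> x" "x \<le> y" for x y
    using step[OF that] Henstock_Kurzweil_Integration.integral_nonneg[OF intf[of x y]] sech_powr_pos[of \<beta>]
    by (simp add: less_imp_le)
  have lim: "(N \<longlongrightarrow> 0) at_top"
    using tendsto_diff[OF tendsto_const integral_Icc_tendsto_Ici[OF ai], of "integral {0..} ?f"]
    unfolding N_def[abs_def] by simp
  have pos: "0 < N y" if y: "0 \<le> y" for y
  proof -
    have "0 \<le> N (y + 1)"
    proof (rule tendsto_upperbound[OF lim])
      show "\<forall>\<^sub>F z in at_top. N z \<le> N (y + 1)"
        using eventually_ge_at_top[of "y + 1"] by eventually_elim (use mono y in simp)
    qed simp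
    moreover have "?f y \<noteq> 0" using sech_powr_pos[of \<beta> y] by linarith
    then have "integral {y..y + 1} ?f \<noteq> 0"
      by (subst integral_eq_0_iff[OF contf]) (auto simp: sech_powr_pos less_imp_le intro!: bexI[of _ y])
    moreover have "0 \<le> integral {y..y + 1} ?f"
      by (rule Henstock_Kurzweil_Integration.integral_nonneg[OF intf]) (simp add: sech_powr_pos less_imp_le)
    moreover have "N (y + 1) = N y - integral {y..y + 1} ?f"
      by (rule step) (use y in auto)
    ultimately show ?thesis by linarith
  qed
  show ?thesis using D pos mono lim by (intro exI[of _ N]) auto
qed

text \<open>For \<open>y > 0\<close> and \<open>\<beta> > 0\<close> this is the integral of
  \<open>sech_powr \<beta>\<close> from \<open>y\<close> to infinity. It has no elementary form for
  general \<open>\<beta>\<close>, so it is handled through these properties only.\<close>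

definition sech_tail :: "real \<Rightarrow> real \<Rightarrow> real" where
  "sech_tail \<beta> = (SOME N. (\<forall>y>0. (N has_real_derivative - sech_powr \<beta> y) (at y)) \<and> (\<forall>y. 0 \<le> y \<longrightarrow> 0 < N y) \<and>
    (\<forall>x y. 0 \<le> x \<longrightarrow> x \<le> y \<longrightarrow> N y \<le> N x) \<and> (N \<longlongrightarrow> 0) at_top)"

lemma sech_tail:
  assumes "0 < \<beta>"
  shows "\<And>y. 0 < y \<Longrightarrow> (sech_tail \<beta> has_real_derivative - sech_powr \<beta> y) (at y)"
    and "\<And>y. 0 \<le> y \<Longrightarrow> 0 < sech_tail \<beta> y"
    and "\<And>x y. 0 \<le> x \<Longrightarrow> x \<le> y \<Longrightarrow> sech_tail \<beta> y \<le> sech_tail \<beta> x"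
    and "(sech_tail \<beta> \<longlongrightarrow> 0) at_top"
  using someI_ex[OF tail_sech_powr[OF assms]] unfolding sech_tail_def[symmetric] by blast+

text \<open>For suitable \<open>a\<close>, \<open>c\<close>, \<open>e\<close> the left-hand side is the mass of the soliton shifted by \<open>t\<close>.\<close>

lemma mass_parameter_exists:
  fixes a e c \<mu> \<beta> :: real
  assumes "0 < a" "0 < e" "0 < c" "0 < \<mu>" "0 < \<beta>"
  obtains t where "0 < t" "c * (a / tanh t) powr e * sech_tail \<beta> t = \<mu>"
proof -
  note N = sech_tail[OF \<open>0 < \<beta>\<close>]
  define F where "F t = c * (a / tanh t) powr e * sech_tail \<beta> t" for t
  have cont: "continuous_on {t1..t2} F" if "0 < t1" for t1 t2
    unfolding F_def
  proof (intro continuous_on_mult continuous_on_const continuous_on_powr continuous_on_divide ballI)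
    show "continuous_on {t1..t2} (sech_tail \<beta>)"
      by (rule continuous_at_imp_continuous_on) (use DERIV_isCont[OF N(1)] that in auto)
    show "continuous_on {t1..t2} tanh" by (intro continuous_intros) (simp add: cosh_real_nonzero)
    show "tanh t \<noteq> 0" "a / tanh t \<noteq> 0" if "t \<in> {t1..t2}" for t
      using that \<open>0 < t1\<close> \<open>0 < a\<close> by auto
  qed
  obtain t1 where t1: "0 < t1" "t1 < 1" "\<mu> \<le> F t1"
  proof -
    \<comment> \<open>\<open>R\<close> is the value of \<open>a / tanh t\<close> at which the
      product with \<open>sech_tail \<beta> 1\<close> equals \<open>\<mu>\<close>. For small
      \<open>t\<close> the quotient exceeds \<open>R\<close>, and for \<open>t < 1\<close> the tail
      is at least its value at 1.\<close>
    define R where "R = (\<mu> / (c * sech_tail \<beta> 1)) powr (1 / e)"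
    have N1: "0 < sech_tail \<beta> 1" using N(2) by simp
    have R: "0 < R" using N1 assms by (simp add: R_def)
    have "(tanh \<longlongrightarrow> tanh (0::real)) (at_right 0)"
      by (intro tendsto_tanh tendsto_ident_at) simp
    then have "\<forall>\<^sub>F t in at_right 0. tanh t < a / R"
      using R \<open>0 < a\<close> by (intro order_tendstoD(2)) auto
    moreover have "\<forall>\<^sub>F t in at_right (0::real). t \<in> {0<..<1}"
      by (rule eventually_at_right_real) simp
    ultimately have "\<forall>\<^sub>F t in at_right 0. tanh t < a / R \<and> t \<in> {0<..<1}" by eventually_elim simp
    then obtain t where t: "tanh t < a / R" "0 < t" "t < 1"
      using eventually_happens'[OF trivial_limit_at_right_real] by fastforce
    have "0 < tanh t" using t by simp
    then have "R \<le> a / tanh t" using t(1) R by (simp add: field_simps)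
    then have "R powr e \<le> (a / tanh t) powr e" using R assms by (intro powr_mono2) auto
    moreover have "R powr e = \<mu> / (c * sech_tail \<beta> 1)"
      using assms N1 by (simp add: R_def powr_powr)
    ultimately have "\<mu> \<le> c * (a / tanh t) powr e * sech_tail \<beta> 1"
      using N1 assms by (simp add: field_simps)
    also have "\<dots> \<le> F t"
      unfolding F_def using t assms N(3)[of t 1] by (intro mult_left_mono) auto
    finally show thesis using that t by blast
  qed
  obtain t2 where t2: "1 \<le> t2" "F t2 \<le> \<mu>"
  proof -
    \<comment> \<open>For \<open>t \<ge> 1\<close> the power factor is at most its value at 1, so
      the decaying tail decides.\<close>
    define K where "K = c * (a / tanh 1) powr e"
    have K: "0 < K" using assms by (simp add: K_def)
    have "\<forall>\<^sub>F t in at_top. sech_tail \<beta> t < \<mu> / K"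
      using N(4) by (rule order_tendstoD) (use K assms in simp)
    then have "\<forall>\<^sub>F t in at_top. sech_tail \<beta> t < \<mu> / K \<and> 1 \<le> t"
      using eventually_ge_at_top[of 1] by eventually_elim simp
    then obtain t where t: "sech_tail \<beta> t < \<mu> / K" "1 \<le> t"
      using eventually_happens'[OF trivial_limit_at_top_linorder] by blast
    have "tanh 1 \<le> tanh t" "0 < tanh (1::real)" using t(2) by simp_all
    then have "(a / tanh t) powr e \<le> (a / tanh 1) powr e"
      using assms by (intro powr_mono2 divide_left_mono) auto
    then have "c * (a / tanh t) powr e \<le> K" using assms by (simp add: K_def)
    then have "F t \<le> K * sech_tail \<beta> t"
      unfolding F_def using N(2)[of t] t by (intro mult_right_mono) auto
    also have "\<dots> \<le> \<mu>" using t(1) K by (simp add: field_simps)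
    finally show thesis using that t by blast
  qed
  have "\<exists>t\<ge>t1. t \<le> t2 \<and> F t = \<mu>"
    using t1 t2 cont[of t1 t2] by (intro IVT2') auto
  then obtain t where "t1 \<le> t" "F t = \<mu>" by blast
  then show thesis using that[of t] t1(1) unfolding F_def by simp
qed

section \<open>The shifted soliton and its differential equations\<close>

locale soliton =
  fixes p \<alpha> t :: real
  assumes p: "2 < p" "p < 6" and \<alpha>: "\<alpha> < 0" and t: "0 < t"
begin

text \<open>The parameters make \<open>u\<close> solve \<open>u'' = s^2 u - u powr (p - 1)\<close>:
  \<open>k\<close> gives the decay rate \<open>s\<close>, and \<open>A\<close> is the matching
  amplitude. The choice of \<open>s\<close> encodes \<open>u' = \<alpha> u\<close> at 0. Moreover
  \<open>w\<close> is \<open>u'\<close>, \<open>G\<close> is the tail mass and \<open>K\<close> is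
  \<open>- u' / u ^ 3\<close>.\<close>

definition "\<beta> = 2 / (p - 2)"
definition "s = - \<alpha> / tanh t"
definition "k = s / \<beta>"
definition "A = (p * s\<^sup>2 / 2) powr (1 / (p - 2))"
definition "u x = A * sech_powr \<beta> (k * x + t)"
definition "w x = - s * tanh (k * x + t) * u x"
definition "G x = A\<^sup>2 / k * sech_tail (2 * \<beta>) (k * x + t)"
definition "K x = s * tanh (k * x + t) / (u x)\<^sup>2"

text \<open>The soliton extends to the left of \<open>0\<close> up to its peak, so that \<open>G\<close> can be inverted on a
  neighbourhood of the full mass.\<close>

definition "J = {- t / k<..}"
definition "Y = inv_into J G"

lemma pos: "0 < \<beta>" "0 < s" "0 < k" "0 < A"
proof -
  show "0 < \<beta>" using p by (simp add: \<beta>_def)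
  show "0 < s" using \<alpha> t by (simp add: s_def divide_neg_pos)
  then show "0 < k" "0 < A" using \<open>0 < \<beta>\<close> p by (simp_all add: k_def A_def)
qed

lemma J: "x \<in> J \<longleftrightarrow> 0 < k * x + t" "0 \<le> x \<Longrightarrow> x \<in> J"
proof -
  have "- t / k < x \<longleftrightarrow> - t < k * x" for x
    using pos_divide_less_eq[OF pos(3), of "- t" x] by (simp only: mult.commute)
  then show *: "x \<in> J \<longleftrightarrow> 0 < k * x + t" for x
    unfolding J_def greaterThan_iff by (simp only:) linarith
  show "0 \<le> x \<Longrightarrow> x \<in> J" using pos(3) t by (simp add: * add_nonneg_pos)
qed

lemma u_pos: "0 < u x"
  using pos by (simp add: u_def sech_powr_pos)

text \<open>Since \<open>\<beta> * (p - 2) = 2\<close>, the power is a multiple of the squared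
  hyperbolic secant. Later identities thus become rational in \<open>u\<close> and
  \<open>tanh\<close>.\<close>

lemma u_powr: "u x powr (p - 2) = p * s\<^sup>2 / 2 * (1 - (tanh (k * x + t))\<^sup>2)"
proof -
  have "A powr (p - 2) = p * s\<^sup>2 / 2" using p pos by (simp add: A_def powr_powr)
  moreover have "\<beta> * (p - 2) = 2"
    using nonzero_eq_divide_eq[of "p - 2" \<beta> 2] p by (simp only: \<beta>_def) simp
  ultimately show ?thesis
    using pos by (simp add: u_def powr_mult sech_powr_powr sech_powr_2 sech_powr_pos less_imp_le)
qed

lemma arg_deriv: "((\<lambda>x. k * x + t) has_real_derivative k) (at x)"
  by (auto intro!: derivative_eq_intros)

lemma u_deriv: "(u has_real_derivative w x) (at x)"
proof -
  have "((\<lambda>x. A * sech_powr \<beta> (k * x + t)) has_real_derivative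
      A * (- \<beta> * tanh (k * x + t) * sech_powr \<beta> (k * x + t) * k)) (at x)"
    by (intro DERIV_cmult DERIV_chain2[OF has_real_derivative_sech_powr arg_deriv])
  then show ?thesis
    using pos unfolding u_def[abs_def] w_def by (simp add: k_def mult_ac)
qed

lemma tanh_deriv:
  "((\<lambda>x. tanh (k * x + t)) has_real_derivative k * (1 - (tanh (k * x + t))\<^sup>2)) (at x)"
  by (auto intro!: derivative_eq_intros arg_deriv simp: cosh_real_nonzero)

lemma w_deriv:
  "(w has_real_derivative - s * k * (1 - (tanh (k * x + t))\<^sup>2) * u x + s\<^sup>2 * (tanh (k * x + t))\<^sup>2 * u x) (at x)"
  unfolding w_def[abs_def]
  by (rule derivative_eq_intros tanh_deriv u_deriv refl)+ (simp add: w_def algebra_simps power2_eq_square)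

lemma G_deriv: "x \<in> J \<Longrightarrow> (G has_real_derivative - (u x)\<^sup>2) (at x)"
proof -
  assume "x \<in> J"
  then have "0 < k * x + t" by (simp add: J)
  then have "((\<lambda>x. A\<^sup>2 / k * sech_tail (2 * \<beta>) (k * x + t)) has_real_derivative
      A\<^sup>2 / k * (- sech_powr (2 * \<beta>) (k * x + t) * k)) (at x)"
    using pos by (intro DERIV_cmult DERIV_chain2[OF sech_tail(1) arg_deriv]) auto
  moreover have "sech_powr (2 * \<beta>) y = (sech_powr \<beta> y)\<^sup>2" for y
    by (simp add: sech_powr_def exp_double[symmetric] mult_ac power2_eq_square exp_add[symmetric])
  ultimately show ?thesis
    using pos unfolding G_def[abs_def] u_def by (simp add: power_mult_distrib)
qed

text \<open>The soliton equation in Riccati form, still in the variable \<open>x\<close>; dividing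
  by the derivative \<open>- u ^ 2\<close> of the tail mass gives the equation demanded of
  \<open>\<kappa>\<close>.\<close>

lemma K_deriv: "(K has_real_derivative 2 * (K x)\<^sup>2 * (u x)\<^sup>2 + (p - 2) / p * u x powr (p - 2) / (u x)\<^sup>2) (at x)"
proof -
  let ?T = "tanh (k * x + t)"
  have "(K has_real_derivative (s * (k * (1 - ?T\<^sup>2)) * (u x)\<^sup>2 - s * ?T * (2 * u x * w x)) / ((u x)\<^sup>2 * (u x)\<^sup>2)) (at x)"
    unfolding K_def[abs_def] using u_pos[of x]
    by (auto intro!: derivative_eq_intros tanh_deriv u_deriv)
  moreover have k: "k = s * (p - 2) / 2" using p by (simp add: k_def \<beta>_def)
  have "(s * (k * (1 - T\<^sup>2)) * V\<^sup>2 - s * T * (2 * V * (- s * T * V))) / (V\<^sup>2 * V\<^sup>2)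
      = 2 * (s * T / V\<^sup>2)\<^sup>2 * V\<^sup>2 + (p - 2) / p * (p * s\<^sup>2 / 2 * (1 - T\<^sup>2)) / V\<^sup>2"
    if "V \<noteq> 0" for T V
    using that p unfolding k by (simp add: field_simps power2_eq_square)
  from this[of "u x" ?T] have "(s * (k * (1 - ?T\<^sup>2)) * (u x)\<^sup>2 - s * ?T * (2 * u x * w x)) / ((u x)\<^sup>2 * (u x)\<^sup>2)
      = 2 * (K x)\<^sup>2 * (u x)\<^sup>2 + (p - 2) / p * u x powr (p - 2) / (u x)\<^sup>2"
    using u_pos[of x] unfolding u_powr K_def w_def by simp
  ultimately show ?thesis by simp
qed

lemma tanh_pos: "x \<in> J \<Longrightarrow> 0 < tanh (k * x + t)"
  by (simp add: J)

lemma abs_w_le: "\<bar>w x\<bar> \<le> s * u x"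
proof -
  have "\<bar>tanh (k * x + t)\<bar> \<le> 1" using tanh_real_bounds[of "k * x + t"] by auto
  then show ?thesis
    using pos u_pos[of x] by (simp add: w_def abs_mult mult_left_le_one_le mult_right_le_one_le)
qed

lemma continuous_on_u: "continuous_on S u" and continuous_on_w: "continuous_on S w"
  by (meson DERIV_isCont continuous_at_imp_continuous_on u_deriv w_deriv)+

lemma arg_at_top: "filterlim (\<lambda>x. k * x + t) at_top at_top"
  using pos(3) by real_asymp

lemma u_tendsto: "(u \<longlongrightarrow> 0) at_top"
proof (rule tendsto_sandwich)
  show "\<forall>\<^sub>F x in at_top. 0 \<le> u x" using u_pos by (simp add: less_imp_le)
  show "\<forall>\<^sub>F x in at_top. u x \<le> A * (exp (\<beta> * ln 2) * exp (- \<beta> * (k * x + t)))"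
    using pos sech_powr_le_exp[of \<beta>] by (simp add: u_def)
  show "((\<lambda>x. A * (exp (\<beta> * ln 2) * exp (- \<beta> * (k * x + t)))) \<longlongrightarrow> 0) at_top"
    using pos by real_asymp
qed simp

lemma tail_u: "x \<in> J \<Longrightarrow> ((\<lambda>y. (u y)\<^sup>2) has_integral G x) {x..}"
proof (rule has_integral_to_inf)
  assume x: "x \<in> J"
  have xy: "y \<in> J" if "x \<le> y" for y using x that by (simp add: J_def)
  have FTC: "((\<lambda>y. (u y)\<^sup>2) has_integral (- G y - - G x)) {x..y}" if "x \<le> y" for y
  proof (rule fundamental_theorem_of_calculus[OF that])
    fix z assume "z \<in> {x..y}"
    then have "((\<lambda>z. - G z) has_real_derivative (u z)\<^sup>2) (at z within {x..y})"
      using DERIV_minus[OF G_deriv[OF xy[of z]]] by (simp add: has_field_derivative_at_within)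
    then show "((\<lambda>z. - G z) has_vector_derivative (u z)\<^sup>2) (at z within {x..y})"
      by (simp add: has_real_derivative_iff_has_vector_derivative)
  qed
  have "((\<lambda>y. G x - G y) \<longlongrightarrow> G x - A\<^sup>2 / k * 0) at_top"
    unfolding G_def using pos
    by (intro tendsto_diff tendsto_const tendsto_mult filterlim_compose[OF sech_tail(4) arg_at_top]) simp
  moreover have "\<forall>\<^sub>F y in at_top. G x - G y = integral {x..y} (\<lambda>y. (u y)\<^sup>2)"
    using eventually_ge_at_top[of x] by eventually_elim (use integral_unique[OF FTC] in simp)
  ultimately show "((\<lambda>y. integral {x..y} (\<lambda>y. (u y)\<^sup>2)) \<longlongrightarrow> G x) at_top"
    using Lim_transform_eventually by fastforce
  show "(\<lambda>y. (u y)\<^sup>2) integrable_on {x..y}" for y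
    by (intro integrable_continuous_interval continuous_on_power continuous_on_u)
qed simp

lemma H1_pair_u: "H1_pair u w"
proof -
  have ai: "(\<lambda>x. (u x)\<^sup>2) absolutely_integrable_on {0..}"
    using tail_u[OF J(2)[of 0]] by (intro nonnegative_absolutely_integrable_1) auto
  have "(\<lambda>x. (w x)\<^sup>2) absolutely_integrable_on {0..}"
  proof (rule measurable_bounded_by_integrable_imp_absolutely_integrable)
    show "(\<lambda>x. (w x)\<^sup>2) \<in> borel_measurable (lebesgue_on {0..})"
      by (intro continuous_imp_measurable_on_sets_lebesgue continuous_on_power continuous_on_w) auto
    show "(\<lambda>x. s\<^sup>2 * (u x)\<^sup>2) integrable_on {0..}"
      using ai by (intro integrable_on_mult_right) (simp add: absolutely_integrable_on_def)
    show "norm ((w x)\<^sup>2) \<le> s\<^sup>2 * (u x)\<^sup>2" for x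
      using power_mono[OF abs_w_le[of x], of 2] by (simp add: power_mult_distrib)
  qed auto
  moreover have "primitive_on 0 X u w" for X
    by (rule primitive_on_C1[OF has_field_derivative_at_within[OF u_deriv] continuous_on_w])
  ultimately show ?thesis using ai by (simp add: H1_pair_def)
qed

lemma mass_u: "integral {0..} (\<lambda>x. (u x)\<^sup>2) = G 0"
  by (rule integral_unique[OF tail_u]) (simp add: J(2))

lemma powr_u: "(\<lambda>x. u x powr p) absolutely_integrable_on {0..}"
proof -
  obtain M where "\<And>x. 0 \<le> x \<Longrightarrow> \<bar>u x\<bar> \<le> M" using H1_pair_bounded[OF H1_pair_u] by blast
  from H1_pair_powr(1)[OF H1_pair_u _ this, of p] show ?thesis
    using p u_pos by (simp add: less_imp_le)
qed

section \<open>Inverting the tail mass of the soliton\<close>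

lemma G_strict: "x \<in> J \<Longrightarrow> x < y \<Longrightarrow> G y < G x"
proof -
  assume x: "x \<in> J" and "x < y"
  show "G y < G x"
  proof (rule DERIV_neg_imp_decreasing[OF \<open>x < y\<close>])
    fix z assume "x \<le> z" "z \<le> y"
    then have "z \<in> J" using x by (simp add: J_def)
    then show "\<exists>d. (G has_real_derivative d) (at z) \<and> d < 0"
      using G_deriv u_pos[of z] by (intro exI[of _ "- (u z)\<^sup>2"]) simp
  qed
qed

lemma inj_G: "inj_on G J"
  using G_strict by (intro linorder_inj_onI') (metis less_irrefl)

lemma Y_G: "x \<in> J \<Longrightarrow> Y (G x) = x"
  unfolding Y_def by (rule inv_into_f_f[OF inj_G])

lemma continuous_on_G: "S \<subseteq> J \<Longrightarrow> continuous_on S G"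
  using G_deriv by (meson DERIV_isCont continuous_at_imp_continuous_on subsetD)

lemma J_left: "x \<in> J \<Longrightarrow> \<exists>a\<in>J. a < x"
  unfolding J_def greaterThan_iff using dense by fast

lemma Y_deriv:
  assumes x: "x \<in> J"
  shows "(Y has_real_derivative - inverse ((u x)\<^sup>2)) (at (G x))"
proof -
  \<comment> \<open>A point of \<open>J\<close> to the left of \<open>x\<close> exists even for
    \<open>x = 0\<close>; it makes \<open>G x\<close> interior to the range on which
    \<open>Y\<close> inverts \<open>G\<close>.\<close>
  obtain a where a: "a \<in> J" "a < x" using J_left[OF x] by blast
  have Ja: "z \<in> J" if "a \<le> z" for z using a that by (simp add: J_def)
  have "(Y has_real_derivative inverse (- (u x)\<^sup>2)) (at (G x))"
  proof (rule DERIV_inverse_function)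
    show "(G has_real_derivative - (u x)\<^sup>2) (at (Y (G x)))"
      using G_deriv[OF x] Y_G[OF x] by simp
    show "- (u x)\<^sup>2 \<noteq> 0" using u_pos[of x] by simp
    show "G (x + 1) < G x" "G x < G a" using G_strict x a by auto
    show "G (Y y) = y" if "G (x + 1) < y" "y < G a" for y
    proof -
      have "\<exists>z\<ge>a. z \<le> x + 1 \<and> G z = y"
      proof (rule IVT2')
        show "continuous_on {a..x + 1} G" by (rule continuous_on_G) (use Ja in auto)
      qed (use that a in auto)
      then obtain z where z: "a \<le> z" "G z = y" by blast
      from Y_G[OF Ja[OF z(1)]] show ?thesis using z(2) by simp
    qed
    have "isCont Y (G x)"
    proof (rule isCont_inverse_function[where d = "x - a" and f = G and x = x])
      show "0 < x - a" using a by simp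
      fix z assume "\<bar>z - x\<bar> \<le> x - a"
      then have "z \<in> J" by (intro Ja) simp
      then show "Y (G z) = z" "isCont G z"
        using Y_G DERIV_isCont[OF G_deriv] by blast+
    qed
    then show "isCont Y (G x)" .
  qed
  then show ?thesis by (simp add: inverse_minus_eq)
qed

lemma G_surj:
  assumes "0 < y" "y \<le> G 0"
  obtains x where "0 \<le> x" "G x = y"
proof (cases "y = G 0")
  case False
  with tail_mass(4)[OF H1_pair_u assms(1)] mass_u assms(2) obtain x
    where x: "0 \<le> x" "integral {x..} (\<lambda>x. (u x)\<^sup>2) = y" by auto
  then show thesis using that integral_unique[OF tail_u[OF J(2)[OF x(1)]]] by auto
qed (use that in auto)

lemma u_powr_p: "u x powr p = (u x)\<^sup>2 * u x powr (p - 2)"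
proof -
  have "u x powr p = u x powr 2 * u x powr (p - 2)"
    by (simp only: powr_add[symmetric]) simp
  then show ?thesis using u_pos[of x] by simp
qed

lemma s_tanh: "s * tanh t = - \<alpha>"
  using t by (simp add: s_def)

definition "T = integral {0..} (\<lambda>x. u x powr p)"

text \<open>The coefficient \<open>(6 - p) / (4 * p)\<close> is the one that makes \<open>f\<close>
  an exact derivative, by the soliton equation and its first integral
  \<open>w^2 = s^2 u^2 - 2 / p * u powr p\<close>. The primitive \<open>h\<close> equals
  \<open>- K * u ^ 4 / 4\<close>, the first part of the calibrating function along the soliton
  itself.\<close>

lemma energy_u: "pair_energy p \<alpha> u w = \<alpha> * (u 0)\<^sup>2 / 4 - (6 - p) / (4 * p) * T"
proof -
  define f where "f x = 1 / 2 * (w x)\<^sup>2 - (1 / p - (6 - p) / (4 * p)) * u x powr p" for x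
  define h where "h x = u x * w x / 4" for x
  note aiw = H1_pairD(3)[OF H1_pair_u]
  have f_ai: "f absolutely_integrable_on {0..}"
    unfolding f_def by (intro set_integral_diff set_integrable_mult_right) (use aiw powr_u in auto)
  have h_deriv: "(h has_real_derivative f x) (at x)" for x
  proof -
    let ?T = "tanh (k * x + t)"
    have "(h has_real_derivative (w x * w x
        + (- s * k * (1 - ?T\<^sup>2) * u x + s\<^sup>2 * ?T\<^sup>2 * u x) * u x) / 4) (at x)"
      unfolding h_def[abs_def] by (intro DERIV_cdivide DERIV_mult u_deriv w_deriv)
    moreover have k: "k = s * (p - 2) / 2" using p by (simp add: k_def \<beta>_def)
    have "((- s * T * V) * (- s * T * V) + (- s * k * (1 - T\<^sup>2) * V + s\<^sup>2 * T\<^sup>2 * V) * V) / 4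
        = 1 / 2 * (- s * T * V)\<^sup>2 - (1 / p - (6 - p) / (4 * p)) * (V\<^sup>2 * (p * s\<^sup>2 / 2 * (1 - T\<^sup>2)))"
      for T V
      using p unfolding k by (simp add: field_simps power2_eq_square)
    from this[of ?T "u x"] have "(w x * w x + (- s * k * (1 - ?T\<^sup>2) * u x + s\<^sup>2 * ?T\<^sup>2 * u x) * u x) / 4 = f x"
      unfolding f_def u_powr_p u_powr w_def .
    ultimately show ?thesis by simp
  qed
  have FTC: "integral {0..X} f = h X - h 0" if "0 \<le> X" for X
    using that h_deriv
    by (intro integral_unique fundamental_theorem_of_calculus)
      (auto simp: has_real_derivative_iff_has_vector_derivative[symmetric] intro: has_field_derivative_at_within)
  have h0: "h 0 = \<alpha> * (u 0)\<^sup>2 / 4"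
    using s_tanh by (simp add: h_def w_def power2_eq_square)
  have "(h \<longlongrightarrow> 0) at_top"
  proof (rule Lim_null_comparison)
    show "\<forall>\<^sub>F x in at_top. norm (h x) \<le> s * (u x * u x) / 4"
      using mult_left_mono[OF abs_w_le less_imp_le[OF u_pos]]
      by (simp add: h_def abs_mult abs_of_pos[OF u_pos] mult.left_commute)
    have "((\<lambda>x. s * (u x * u x) / 4) \<longlongrightarrow> s * (0 * 0) / 4) at_top"
      by (intro tendsto_intros u_tendsto) simp
    then show "((\<lambda>x. s * (u x * u x) / 4) \<longlongrightarrow> 0) at_top" by simp
  qed
  then have "((\<lambda>X. h X - h 0) \<longlongrightarrow> 0 - h 0) at_top" by (intro tendsto_diff tendsto_const)
  moreover have "\<forall>\<^sub>F X in at_top. h X - h 0 = integral {0..X} f"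
    using eventually_ge_at_top[of 0] by eventually_elim (simp add: FTC)
  ultimately have "((\<lambda>X. integral {0..X} f) \<longlongrightarrow> 0 - h 0) at_top"
    by (rule Lim_transform_eventually)
  from tendsto_unique[OF _ this integral_Icc_tendsto_Ici[OF f_ai]] have "integral {0..} f = - h 0" by simp
  moreover have "integral {0..} f = 1 / 2 * integral {0..} (\<lambda>x. (w x)\<^sup>2) - (1 / p - (6 - p) / (4 * p)) * T"
  proof -
    have "(\<lambda>x. (w x)\<^sup>2) integrable_on {0..}" "(\<lambda>x. u x powr p) integrable_on {0..}"
      using aiw powr_u by (auto simp: absolutely_integrable_on_def)
    from Henstock_Kurzweil_Integration.integral_diff[OF
        integrable_on_mult_right[OF this(1), of "1 / 2"]
        integrable_on_mult_right[OF this(2), of "1 / p - (6 - p) / (4 * p)"]]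
    show ?thesis
      unfolding f_def T_def by (simp only: Henstock_Kurzweil_Integration.integral_mult_right)
  qed
  ultimately have "1 / 2 * integral {0..} (\<lambda>x. (w x)\<^sup>2) - 1 / p * T = - h 0 - (6 - p) / (4 * p) * T"
    unfolding left_diff_distrib by linarith
  moreover have "pair_energy p \<alpha> u w = 1 / 2 * integral {0..} (\<lambda>x. (w x)\<^sup>2) - 1 / p * T + \<alpha> / 2 * (u 0)\<^sup>2"
    using u_pos by (simp add: pair_energy_def T_def less_imp_le)
  ultimately show ?thesis using h0 by simp
qed

text \<open>Starting at -1 makes \<open>V\<close> differentiable from both sides at 0; the quantity
  of interest is \<open>V x - V 0\<close>.\<close>

definition "V x = integral {-1..x} (\<lambda>x. u x powr p)"

lemma continuous_on_u_powr: "continuous_on S (\<lambda>x. u x powr p)"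
  using u_pos by (intro continuous_on_powr continuous_on_u continuous_on_const) (metis less_irrefl)

lemma V_deriv: "0 \<le> x \<Longrightarrow> (V has_real_derivative u x powr p) (at x)"
proof -
  assume x: "0 \<le> x"
  have "(V has_real_derivative u x powr p) (at x within {-1..x + 1})"
    unfolding V_def[abs_def] using x by (intro integral_has_real_derivative continuous_on_u_powr) auto
  moreover have "at x within {-1..x + 1} = at x"
    using x by (intro at_within_interior) (auto simp: interior_atLeastAtMost_real)
  ultimately show ?thesis by simp
qed

lemma V_le: "0 \<le> x \<Longrightarrow> V x - V 0 \<le> T"
proof -
  assume x: "0 \<le> x"
  have "integral {-1..0} (\<lambda>x. u x powr p) + integral {0..x} (\<lambda>x. u x powr p) = V x"
    unfolding V_def using x
    by (intro Henstock_Kurzweil_Integration.integral_combine integrable_continuous_interval continuous_on_u_powr) auto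
  moreover have "integral {0..x} (\<lambda>x. u x powr p) \<le> T"
    unfolding T_def by (rule integral_Icc_le_Ici[OF powr_u]) auto
  ultimately show ?thesis by (simp add: V_def)
qed

text \<open>Each differential condition is one for the soliton in \<open>x\<close>, transported by
  \<open>Y\<close>, whose derivative is \<open>- 1 / u ^ 2\<close>; the condition at full mass is
  the boundary condition at 0.\<close>

lemma calibration: "calibration p \<alpha> (G 0) T (\<lambda>y. K (Y y)) (\<lambda>y. u (Y y)) (\<lambda>y. V (Y y) - V 0)"
proof
  show "2 < p" "p < 6" "\<alpha> < 0" by (fact p \<alpha>)+
  have "0 < sech_tail (2 * \<beta>) t" using sech_tail(2)[of "2 * \<beta>" t] pos t by simp
  then show "0 < G 0" using pos by (simp add: G_def)
  have Y0: "Y (G 0) = 0" by (rule Y_G) (simp add: J(2))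
  show "V (Y (G 0)) - V 0 = 0" by (simp add: Y0)
  show "K (Y (G 0)) * (u (Y (G 0)))\<^sup>2 = - \<alpha>"
    using u_pos[of 0] s_tanh by (simp add: Y0 K_def)
  show "continuous_on {0<..G 0} (\<lambda>y. u (Y y))"
  proof (rule continuous_at_imp_continuous_on, rule ballI)
    fix y assume "y \<in> {0<..G 0}"
    then obtain x where x: "0 \<le> x" "G x = y" using G_surj[of y] by auto
    then have "isCont Y y" using DERIV_isCont[OF Y_deriv[OF J(2)[OF x(1)]]] by simp
    moreover have "isCont u (Y y)" by (rule DERIV_isCont[OF u_deriv])
    ultimately show "isCont (\<lambda>y. u (Y y)) y" by (rule isCont_o2)
  qed
  fix y assume "0 < y" "y \<le> G 0"
  then obtain x where x: "0 \<le> x" "G x = y" by (rule G_surj)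
  have xJ: "x \<in> J" using x(1) by (rule J(2))
  have Y: "Y y = x" using Y_G[OF xJ] x(2) by simp
  have dY: "(Y has_real_derivative - inverse ((u (Y y))\<^sup>2)) (at y)"
    using Y_deriv[OF xJ] x(2) Y by simp
  show "0 < u (Y y)" by (rule u_pos)
  show "0 < K (Y y)" using pos tanh_pos[OF xJ] u_pos[of x] by (simp add: Y K_def)
  show "V (Y y) - V 0 \<le> T" using V_le[OF x(1)] by (simp add: Y)
  have u4: "u z powr (p - 6) * (u z)\<^sup>2 * (u z)\<^sup>2 = u z powr (p - 2)" for z
  proof -
    have "u z powr (p - 2) = u z powr (p - 6) * u z powr 4"
      by (simp only: powr_add[symmetric]) simp
    then show ?thesis using u_pos[of z] by (simp add: power4_eq_xxxx power2_eq_square mult.assoc)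
  qed
  have "((\<lambda>y. K (Y y)) has_real_derivative (2 * (K (Y y))\<^sup>2 * (u (Y y))\<^sup>2
      + (p - 2) / p * u (Y y) powr (p - 2) / (u (Y y))\<^sup>2) * - inverse ((u (Y y))\<^sup>2)) (at y)"
    by (rule DERIV_chain2[OF K_deriv dY])
  moreover have "(2 * (K (Y y))\<^sup>2 * (u (Y y))\<^sup>2
      + (p - 2) / p * u (Y y) powr (p - 2) / (u (Y y))\<^sup>2) * - inverse ((u (Y y))\<^sup>2)
      = - 2 * (K (Y y))\<^sup>2 - (p - 2) / p * u (Y y) powr (p - 6)"
    using u_pos[of "Y y"] p unfolding u4[symmetric] by (simp add: field_simps)
  ultimately show "((\<lambda>y. K (Y y)) has_real_derivative
      - 2 * (K (Y y))\<^sup>2 - (p - 2) / p * u (Y y) powr (p - 6)) (at y)"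
    by simp
  have "((\<lambda>y. V (Y y) - V 0) has_real_derivative u (Y y) powr p * - inverse ((u (Y y))\<^sup>2) - 0) (at y)"
    by (intro DERIV_diff DERIV_const DERIV_chain2[OF V_deriv dY]) (simp add: Y x(1))
  moreover have "u (Y y) powr p * - inverse ((u (Y y))\<^sup>2) - 0 = - (u (Y y) powr (p - 2))"
    using u_pos[of "Y y"] by (simp add: u_powr_p field_simps)
  ultimately show "((\<lambda>y. V (Y y) - V 0) has_real_derivative - (u (Y y) powr (p - 2))) (at y)"
    by simp
qed

sublocale calibration p \<alpha> "G 0" T "\<lambda>y. K (Y y)" "\<lambda>y. u (Y y)" "\<lambda>y. V (Y y) - V 0"
  by (rule calibration)

lemma energy_u_eq_level: "pair_energy p \<alpha> u w = level"
  by (simp add: energy_u level_def Y_G J(2))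

text \<open>\<open>Y (m y)\<close> is the place where the soliton has the tail mass that
  \<open>v\<close> has at \<open>y\<close>. Since \<open>v\<close> takes the soliton's value there,
  this place moves with speed \<open>v ^ 2 / u ^ 2 = 1\<close>; it starts at 0 because the total
  masses agree, so it is \<open>y\<close> itself.\<close>

lemma minimizer_unique:
  assumes v: "H1_pair v g" and mass: "integral {0..} (\<lambda>x. (v x)\<^sup>2) = G 0"
    and v_pos: "\<And>x. 0 < x \<Longrightarrow> 0 < v x" and eq: "pair_energy p \<alpha> v g = level" and x: "0 < x"
  shows "v x = u x"
proof -
  define m where "m x = integral {x..} (\<lambda>x. (v x)\<^sup>2)" for x
  have m0: "m 0 = G 0" using mass by (simp add: m_def)
  have m_pos: "0 < m y" if "0 \<le> y" for y
    using energy_eq_level(1)[OF v mass v_pos eq, of y] \<mu> m0 that by (cases "y = 0") (auto simp: m_def)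
  have v_eq: "v y = u (Y (m y))" if "0 < y" for y
    using energy_eq_level(2)[OF v mass v_pos eq that] by (simp add: m_def)
  have z_deriv: "((\<lambda>y. Y (m y)) has_real_derivative - inverse ((u (Y (m y)))\<^sup>2) * - (v y)\<^sup>2) (at y within {0..x})"
    if y: "y \<in> {0..x}" for y
  proof -
    have "0 \<le> y" using y by simp
    have "m y \<le> G 0" using tail_mass(1)[OF v, of 0 y] m0 y by (simp add: m_def)
    with m_pos[OF \<open>0 \<le> y\<close>] obtain q where q: "0 \<le> q" "G q = m y" by (rule G_surj)
    have "(Y has_real_derivative - inverse ((u (Y (m y)))\<^sup>2)) (at (m y))"
      using Y_deriv[OF J(2)[OF q(1)]] Y_G[OF J(2)[OF q(1)]] q(2) by simp
    moreover have "(m has_real_derivative - (v y)\<^sup>2) (at y within {0..x})"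
      using tail_mass(3)[OF v y] unfolding m_def[abs_def] .
    ultimately show ?thesis by (rule DERIV_chain2)
  qed
  \<comment> \<open>Speed 1 is available only for \<open>y > 0\<close>, where \<open>v\<close> is
    identified. The mean value theorem asks for no more in the interior and for mere continuity at
    the ends.\<close>
  have inner: "((\<lambda>y. Y (m y)) has_real_derivative 1) (at y)" if y: "0 < y" "y < x" for y
  proof -
    have "at y within {0..x} = at y"
      using y by (intro at_within_interior) (auto simp: interior_atLeastAtMost_real)
    moreover have "- inverse ((u (Y (m y)))\<^sup>2) * - (v y)\<^sup>2 = 1"
      using u_pos[of "Y (m y)"] by (simp add: v_eq[OF y(1)])
    ultimately show ?thesis using z_deriv[of y] y by simp
  qed
  obtain l z where lz: "0 < z" "z < x" "((\<lambda>y. Y (m y)) has_real_derivative l) (at z)"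
    "Y (m x) - Y (m 0) = (x - 0) * l"
    using MVT[OF x DERIV_continuous_on[OF z_deriv]] inner real_differentiable_def by blast
  have "l = 1" using DERIV_unique[OF lz(3) inner[OF lz(1,2)]] .
  then have "Y (m x) = x" using lz(4) m0 Y_G[OF J(2)[of 0]] by simp
  then show ?thesis using v_eq[OF x] by simp
qed

end

text \<open>\<open>A ^ 2\<close> scales like \<open>s powr (4 / (p - 2))\<close> and
  \<open>k\<close> like \<open>s\<close>, so \<open>A ^ 2 / k\<close> carries the exponent
  \<open>(6 - p) / (p - 2)\<close>. It is positive for \<open>p < 6\<close>, hence the mass is
  unbounded as \<open>t\<close> tends to 0 and \<open>s\<close> to infinity, while it vanishes as
  \<open>t\<close> grows.\<close>

lemma soliton_of_mass_exists:
  fixes p \<alpha> \<mu> :: real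
  assumes "2 < p" "p < 6" "\<alpha> < 0" "0 < \<mu>"
  obtains t where "soliton p \<alpha> t" "soliton.G p \<alpha> t 0 = \<mu>"
proof -
  define b where "b = 2 / (p - 2)"
  have b: "0 < b" using assms by (simp add: b_def)
  have "0 < - \<alpha>" "0 < (6 - p) / (p - 2)" "0 < b * (p / 2) powr b" "0 < 2 * b"
    using assms b by auto
  from mass_parameter_exists[OF this(1,2,3) \<open>0 < \<mu>\<close> this(4)] obtain t where t_pos: "0 < t" and t_mass:
    "b * (p / 2) powr b * (- \<alpha> / tanh t) powr ((6 - p) / (p - 2)) * sech_tail (2 * b) t = \<mu>" .
  interpret soliton p \<alpha> t by unfold_locales (use assms t_pos in auto)
  have b_eq: "\<beta> = b" by (simp add: b_def \<beta>_def)
  have "A\<^sup>2 = A powr 2" using pos(4) by simp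
  also have "\<dots> = (p / 2 * (s * s)) powr b"
    by (simp add: A_def powr_powr b_def power2_eq_square)
  also have "\<dots> = (p / 2) powr b * (s powr b * s powr b)"
    using powr_mult[of "p / 2" "s * s" b] powr_mult[of s s b] assms pos(2) by simp
  also have "s powr b * s powr b = s powr (b + b)" by (simp only: powr_add)
  also have "b + b = 4 / (p - 2)" by (simp add: b_def)
  also have "4 / (p - 2) = (6 - p) / (p - 2) + 1"
    using assms by (simp add: divide_add_eq_iff)
  also have "s powr ((6 - p) / (p - 2) + 1) = s powr ((6 - p) / (p - 2)) * s"
    using pos(2) by (simp add: powr_add)
  finally have "A\<^sup>2 / k = b * (p / 2) powr b * s powr ((6 - p) / (p - 2))"
    using pos(2) by (simp add: k_def b_eq)
  then have "G 0 = \<mu>" using t_mass by (simp add: G_def s_def b_eq)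
  then show thesis using that soliton_axioms by blast
qed

section \<open>Existence and uniqueness of the positive ground state\<close>

theorem theorem1p1:
  fixes p \<alpha> :: real
  assumes "2 < p" and "p < 6" and "\<alpha> < 0"
  shows "\<forall>\<mu>>0. \<exists>u. ground_state p \<alpha> \<mu> u \<and> positive_on_half_line u \<and>
           (\<forall>v. ground_state p \<alpha> \<mu> v \<and> positive_on_half_line v \<longrightarrow> (AE x in half_line. v x = u x))"
proof (intro allI impI)
  fix \<mu> :: real assume "0 < \<mu>"
  obtain t where sol: "soliton p \<alpha> t" "soliton.G p \<alpha> t 0 = \<mu>"
    by (rule soliton_of_mass_exists[OF assms \<open>0 < \<mu>\<close>])
  interpret soliton p \<alpha> t by (rule sol(1))
  note G0 = sol(2)
  have p2: "2 \<le> p" using assms by simp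
  note uH1 = H1_of_H1_pair[OF H1_pair_u]
  have gu: "AE x in half_line. w x = weak_deriv u x" using uH1(3) by eventually_elim simp
  have u_energy: "energy p \<alpha> u = level" "(LINT x|half_line. \<bar>u x\<bar>\<^sup>2) = \<mu>"
    using energy_eq_pair_energy[OF H1_pair_u p2 _ uH1(2) gu] energy_u_eq_level mass_u G0 by auto
  have u_mem: "u \<in> H1_mass \<mu>" using uH1(1) u_energy(2) by (simp add: H1_mass_def)
  \<comment> \<open>Mass, energy and positivity of a competitor are all read off its continuous
    representative; almost everywhere equality with \<open>v\<close> returns only in the final
    conclusion.\<close>
  have pair: "H1_pair (cont_rep v) (weak_deriv v)" "AE x in half_line. cont_rep v x = v x"
    "energy p \<alpha> v = pair_energy p \<alpha> (cont_rep v) (weak_deriv v)"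
    "integral {0..} (\<lambda>x. (cont_rep v x)\<^sup>2) = G 0" if "v \<in> H1_mass \<mu>" for v
  proof -
    have v: "v \<in> H1" "(LINT x|half_line. \<bar>v x\<bar>\<^sup>2) = \<mu>" using that by (auto simp: H1_mass_def)
    show rep: "H1_pair (cont_rep v) (weak_deriv v)" "AE x in half_line. cont_rep v x = v x"
      using H1_pair_of_H1[OF v(1)] by auto
    have "AE x in half_line. weak_deriv v x = weak_deriv v x" by simp
    from energy_eq_pair_energy[OF rep(1) p2 rep(2) refl this]
    show "energy p \<alpha> v = pair_energy p \<alpha> (cont_rep v) (weak_deriv v)"
      "integral {0..} (\<lambda>x. (cont_rep v x)\<^sup>2) = G 0"
      using v(2) G0 by auto
  qed
  have inf: "energy_level p \<alpha> \<mu> = ereal level"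
  proof (rule antisym)
    show "energy_level p \<alpha> \<mu> \<le> ereal level"
      unfolding energy_level_def u_energy(1)[symmetric] by (rule INF_lower[OF u_mem])
    show "ereal level \<le> energy_level p \<alpha> \<mu>"
      unfolding energy_level_def
    proof (rule INF_greatest)
      fix v assume "v \<in> H1_mass \<mu>"
      from pair[OF this] show "ereal level \<le> ereal (energy p \<alpha> v)"
        using energy_ge_level[of "cont_rep v" "weak_deriv v"] by simp
    qed
  qed
  have "ground_state p \<alpha> \<mu> u"
    using u_mem u_energy(1) inf by (simp add: ground_state_def)
  moreover have "positive_on_half_line u"
    using uH1(2) u_pos by (simp add: positive_on_half_line_def)
  moreover have "AE x in half_line. v x = u x" if v: "ground_state p \<alpha> \<mu> v" "positive_on_half_line v" for v
  proof -
    have mem: "v \<in> H1_mass \<mu>" and "energy p \<alpha> v = level"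
      using v(1) inf by (auto simp: ground_state_def)
    with pair(3)[OF mem] have eq: "pair_energy p \<alpha> (cont_rep v) (weak_deriv v) = level" by simp
    have v_pos: "0 < cont_rep v y" if "0 < y" for y
      using v(2) that by (simp add: positive_on_half_line_def)
    have "AE x in half_line. 0 < x"
      by (rule AE_I2) simp
    with pair(2)[OF mem] show ?thesis
    proof eventually_elim
      case (elim x)
      then show ?case using minimizer_unique[OF pair(1)[OF mem] pair(4)[OF mem] v_pos eq, of x] by simp
    qed
  qed
  ultimately show "\<exists>u. ground_state p \<alpha> \<mu> u \<and> positive_on_half_line u \<and>
      (\<forall>v. ground_state p \<alpha> \<mu> v \<and> positive_on_half_line v \<longrightarrow> (AE x in half_line. v x = u x))"
    by blast
qed

end
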